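(* Let $r,k$ be integers with $0<k<r$ and $\gcd(r,k)=1$. Set $n=r+k$, $m=r-k$ if $rk\equiv 0\bmod 2$, and $n=\frac{r+k}{2}$, $m=\frac{r-k}{2}$ if $rk\equiv 1\bmod 2$. Then the minimal isometric immersion of the bipolar surface $\tilde\tau_{r,k}\to\mathbb S^4\subset\mathbb R^5$ is given (in the coordinates $(x,y)$ on $\mathbb R^2$ described in the context, and up to a linear isometry onto $\mathbb R^5$ of the hyperplane containing the image) by $$\left(\varphi_0(y),\ \cos(mx)\varphi_1(y),\ \sin(mx)\varphi_1(y),\ \cos(nx)\varphi_2(y),\ \sin(nx)\varphi_2(y)\right)\in\mathbb S^4,$$ where $$\varphi_0(y)=\sqrt{\frac{n^2+m^2}{2n^2}}\left(1-\frac{n^2-m^2}{2\wp(y;a_{11},a_{12})+b_1}\right),$$ $$\varphi_1(y)=\frac{1}{\sqrt2}\left(-1+\frac{n^2}{2\wp\left(y+\frac1nK\left(\frac mn\right);a_{21},a_{22}\right)+b_2}\right),$$ $$\varphi_2(y)=\sqrt{\frac{n^2-m^2}{2n^2}}\left(1+\frac{m^2}{2\wp(y;a_{31},a_{32})+b_3}\right),$$ with constants $$a_{11}=n^2m^2+\tfrac{(m^2+n^2)^2}{12},\quad a_{12}=-\tfrac{n^2m^2(m^2+n^2)}{6}+\tfrac{(m^2+n^2)^3}{216},$$ $$a_{21}=m^2(m^2-n^2)+\tfrac{(2m^2-n^2)^2}{12},\quad a_{22}=\tfrac{m^2(m^2-n^2)(2m^2-n^2)}{6}-\tfrac{(2m^2-n^2)^3}{216},$$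 $$a_{31}=n^2(n^2-m^2)+\tfrac{(2n^2-m^2)^2}{12},\quad a_{32}=\tfrac{n^2(n^2-m^2)(2n^2-m^2)}{6}-\tfrac{(2n^2-m^2)^3}{216},$$ $$b_1=\tfrac{n^2-5m^2}{6},\quad b_2=\tfrac{4m^2+n^2}{6},\quad b_3=\tfrac{4n^2-5m^2}{6}.$$
   Context: Bipolar surface. For integers $r>k>0$ with $\gcd(r,k)=1$, Lawson's surface $\tau_{r,k}$ is minimally immersed in the unit sphere $\mathbb S^3\subset\mathbb R^4$ by $$I(u,v)=(\cos ru\cos v,\ \sin ru\cos v,\ \cos ku\sin v,\ \sin ku\sin v),\qquad (u,v)\in\mathbb R^2,$$ with unit normal (tangent to $\mathbb S^3$) $$I^*(u,v)=\frac{(k\sin ru\sin v,\,-k\cos ru\sin v,\,-r\sin ku\cos v,\,r\cos ku\cos v)}{\sqrt{r^2\cos^2v+k^2\sin^2v}}.$$ Put $\tilde I=I\wedge I^*:\mathbb R^2\to\mathbb S^5\subset\Lambda^2\mathbb R^4\cong\mathbb R^6$, which is an immersion whose image lies in a great sphere $\mathbb S^4$ of $\mathbb S^5$, i.e. in a hyperplane of $\mathbb R^6$. The bipolar surface $\tilde\tau_{r,k}$ is the quotient of $\mathbb R^2$ by the group of all diffeomorphisms $\sigma$ of $\mathbb R^2$ with $\tilde I\circ\sigma=\tilde I$, endowed with the metric induced by $\tilde I$ from the round metric of the unit sphere; its minimal isometric immersion is the one induced by $\tilde I$. Notation. $\wp(\cdot\,;g_2,g_3)$ is the Weierstrass function with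 invariants $g_2,g_3$, i.e. $(\wp')^2=4\wp^3-g_2\wp-g_3$; the formulas for the $\varphi_i$ are extended by continuity at the poles of $\wp$. $K(\alpha)=\int_0^{\pi/2}\frac{d\theta}{\sqrt{1-\alpha^2\sin^2\theta}}$ is the complete elliptic integral of the first kind. Coordinates $(x,y)$. With $n,m$ as in the claim, $$z=\frac{1}{n+m}\int_0^v\frac{dt}{\sqrt{1-\left(\frac{2\sqrt{mn}}{n+m}\right)^2\sin^2t}},\qquad y=2z+\frac1nK\left(\frac mn\right),$$ and $x=u$ if $rk\equiv0\bmod 2$, $x=2u$ if $rk\equiv1\bmod 2$. *)

theory Defs
  imports "HOL-Complex_Analysis.Complex_Analysis"
begin

no_notation fps_nth (infixl "$" 75)  (* ambiguous with vec_nth *)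

section \<open>Lawson surfaces and their bipolar surfaces\<close>

definition lawson :: "int \<Rightarrow> int \<Rightarrow> real \<times> real \<Rightarrow> real^4" where
  "lawson r k = (\<lambda>(u, v). vector
     [cos (r * u) * cos v, sin (r * u) * cos v, cos (k * u) * sin v, sin (k * u) * sin v])"

definition lawson_normal :: "int \<Rightarrow> int \<Rightarrow> real \<times> real \<Rightarrow> real^4" where
  "lawson_normal r k = (\<lambda>(u, v).
     (1 / sqrt (r\<^sup>2 * (cos v)\<^sup>2 + k\<^sup>2 * (sin v)\<^sup>2)) *\<^sub>R vector
     [k * sin (r * u) * sin v, - k * cos (r * u) * sin v,
      - r * sin (k * u) * cos v, r * cos (k * u) * cos v])"

text \<open>The second exterior power of \<open>\<real>\<^sup>4\<close> is identified with \<open>\<real>\<^sup>6\<close> through the orthonormal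
  basis \<open>e\<^sub>i \<and> e\<^sub>j\<close>, \<open>i < j\<close>, in lexicographic order.\<close>

definition wedge :: "real^4 \<Rightarrow> real^4 \<Rightarrow> real^6" where
  "wedge a b = vector
     [a$1 * b$2 - a$2 * b$1, a$1 * b$3 - a$3 * b$1, a$1 * b$4 - a$4 * b$1,
      a$2 * b$3 - a$3 * b$2, a$2 * b$4 - a$4 * b$2, a$3 * b$4 - a$4 * b$3]"

definition bipolar_lift :: "int \<Rightarrow> int \<Rightarrow> real \<times> real \<Rightarrow> real^6" where
  "bipolar_lift r k p = wedge (lawson r k p) (lawson_normal r k p)"

text \<open>\<open>C_diff j f\<close> says that \<open>f\<close> is \<open>j\<close> times continuously differentiable: for finite-dimensional
  domains, \<open>f\<close> is \<open>C\<^sup>j\<^sup>+\<^sup>1\<close> iff it is differentiable and each of its directional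
  derivatives is \<open>C\<^sup>j\<close>.\<close>

primrec C_diff :: "nat \<Rightarrow> ('a::euclidean_space \<Rightarrow> 'b::real_normed_vector) \<Rightarrow> bool" where
  "C_diff 0 f \<longleftrightarrow> continuous_on UNIV f"
| "C_diff (Suc j) f \<longleftrightarrow> (\<forall>p. f differentiable (at p)) \<and>
     (\<forall>h. C_diff j (\<lambda>p. frechet_derivative f (at p) h))"

definition smooth_map :: "('a::euclidean_space \<Rightarrow> 'b::real_normed_vector) \<Rightarrow> bool" where
  "smooth_map f \<longleftrightarrow> (\<forall>j. C_diff j f)"

definition diffeo :: "('a::euclidean_space \<Rightarrow> 'a) \<Rightarrow> bool" where
  "diffeo \<sigma> \<longleftrightarrow> bij \<sigma> \<and> smooth_map \<sigma> \<and> smooth_map (inv \<sigma>)"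

definition bipolar_group :: "int \<Rightarrow> int \<Rightarrow> (real \<times> real \<Rightarrow> real \<times> real) set" where
  "bipolar_group r k = {\<sigma>. diffeo \<sigma> \<and> bipolar_lift r k \<circ> \<sigma> = bipolar_lift r k}"

definition bipolar_proj :: "int \<Rightarrow> int \<Rightarrow> real \<times> real \<Rightarrow> (real \<times> real) set" where
  "bipolar_proj r k p = (\<lambda>\<sigma>. \<sigma> p) ` bipolar_group r k"

text \<open>The points of the bipolar surface are the orbits of the group. Its metric is the pullback of
  the round metric under the immersion below, which is therefore isometric by definition.\<close>

definition bipolar_surface :: "int \<Rightarrow> int \<Rightarrow> (real \<times> real) set set" where
  "bipolar_surface r k = range (bipolar_proj r k)"

text \<open>The lift is constant on orbits, so \<open>bipolar_lift r k ` X\<close> is a singleton for every orbit \<open>X\<close>.\<close>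

definition bipolar_immersion :: "int \<Rightarrow> int \<Rightarrow> (real \<times> real) set \<Rightarrow> real^6" where
  "bipolar_immersion r k X = the_elem (bipolar_lift r k ` X)"


section \<open>The Weierstrass function with given invariants\<close>

text \<open>The differential equation alone also admits the translates of the Weierstrass function (and
  constants); the normalisation \<open>z\<^sup>2 \<wp>(z) \<longlongrightarrow> 1\<close> at \<open>0\<close> singles out the solution with its
  double pole at the origin. A nicely meromorphic function takes the value \<open>0\<close> at its poles.\<close>

definition is_weierstrass :: "complex \<Rightarrow> complex \<Rightarrow> (complex \<Rightarrow> complex) \<Rightarrow> bool" where
  "is_weierstrass g2 g3 P \<longleftrightarrow>
     P nicely_meromorphic_on UNIV \<and>
     ((\<lambda>z. z\<^sup>2 * P z) \<longlongrightarrow> 1) (at 0) \<and>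
     (\<forall>z. \<not> is_pole P z \<longrightarrow> (deriv P z)\<^sup>2 = 4 * P z ^ 3 - g2 * P z - g3)"

definition weierstrass :: "complex \<Rightarrow> complex \<Rightarrow> complex \<Rightarrow> complex" where
  "weierstrass g2 g3 = (THE P. is_weierstrass g2 g3 P)"

text \<open>The formulas below evaluate the function with real invariants at real arguments, where it is
  real, so that nothing is lost by taking real parts.\<close>

definition wp :: "real \<Rightarrow> real \<Rightarrow> real \<Rightarrow> real" where
  "wp g2 g3 t = Re (weierstrass (of_real g2) (of_real g3) (of_real t))"

definition wp_pole :: "real \<Rightarrow> real \<Rightarrow> real \<Rightarrow> bool" where
  "wp_pole g2 g3 t \<longleftrightarrow> is_pole (weierstrass (of_real g2) (of_real g3)) (of_real t)"

text \<open>\<open>F (\<wp>(t; g2, g3))\<close>, extended by continuity at the poles of \<open>\<wp>\<close>.\<close>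

definition wp_extend :: "(real \<Rightarrow> real) \<Rightarrow> real \<Rightarrow> real \<Rightarrow> real \<Rightarrow> real" where
  "wp_extend F g2 g3 t =
     (if wp_pole g2 g3 t then Lim (at t) (\<lambda>s. F (wp g2 g3 s)) else F (wp g2 g3 t))"


section \<open>The explicit parametrisation\<close>

definition ellK :: "real \<Rightarrow> real" where
  "ellK \<alpha> = (LBINT \<theta>=0..pi/2. 1 / sqrt (1 - \<alpha>\<^sup>2 * (sin \<theta>)\<^sup>2))"

definition phi0 :: "real \<Rightarrow> real \<Rightarrow> real \<Rightarrow> real" where
  "phi0 n m y =
    (let a11 = n\<^sup>2 * m\<^sup>2 + (m\<^sup>2 + n\<^sup>2)\<^sup>2 / 12;
         a12 = - (n\<^sup>2 * m\<^sup>2 * (m\<^sup>2 + n\<^sup>2) / 6) + (m\<^sup>2 + n\<^sup>2) ^ 3 / 216;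
         b1 = (n\<^sup>2 - 5 * m\<^sup>2) / 6
     in wp_extend (\<lambda>w. sqrt ((n\<^sup>2 + m\<^sup>2) / (2 * n\<^sup>2)) * (1 - (n\<^sup>2 - m\<^sup>2) / (2 * w + b1))) a11 a12 y)"

definition phi1 :: "real \<Rightarrow> real \<Rightarrow> real \<Rightarrow> real" where
  "phi1 n m y =
    (let a21 = m\<^sup>2 * (m\<^sup>2 - n\<^sup>2) + (2 * m\<^sup>2 - n\<^sup>2)\<^sup>2 / 12;
         a22 = m\<^sup>2 * (m\<^sup>2 - n\<^sup>2) * (2 * m\<^sup>2 - n\<^sup>2) / 6 - (2 * m\<^sup>2 - n\<^sup>2) ^ 3 / 216;
         b2 = (4 * m\<^sup>2 + n\<^sup>2) / 6
     in wp_extend (\<lambda>w. 1 / sqrt 2 * (- 1 + n\<^sup>2 / (2 * w + b2))) a21 a22 (y + 1 / n * ellK (m / n)))"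

definition phi2 :: "real \<Rightarrow> real \<Rightarrow> real \<Rightarrow> real" where
  "phi2 n m y =
    (let a31 = n\<^sup>2 * (n\<^sup>2 - m\<^sup>2) + (2 * n\<^sup>2 - m\<^sup>2)\<^sup>2 / 12;
         a32 = n\<^sup>2 * (n\<^sup>2 - m\<^sup>2) * (2 * n\<^sup>2 - m\<^sup>2) / 6 - (2 * n\<^sup>2 - m\<^sup>2) ^ 3 / 216;
         b3 = (4 * n\<^sup>2 - 5 * m\<^sup>2) / 6
     in wp_extend (\<lambda>w. sqrt ((n\<^sup>2 - m\<^sup>2) / (2 * n\<^sup>2)) * (1 + m\<^sup>2 / (2 * w + b3))) a31 a32 y)"

definition bipolar_map :: "real \<Rightarrow> real \<Rightarrow> real \<Rightarrow> real \<Rightarrow> real^5" where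
  "bipolar_map n m x y = vector
     [phi0 n m y, cos (m * x) * phi1 n m y, sin (m * x) * phi1 n m y,
      cos (n * x) * phi2 n m y, sin (n * x) * phi2 n m y]"

definition coord_x :: "int \<Rightarrow> int \<Rightarrow> real \<Rightarrow> real" where
  "coord_x r k u = (if even (r * k) then u else 2 * u)"

text \<open>The interval integral is oriented, so negative values of \<open>v\<close> are covered as well.\<close>

definition coord_z :: "real \<Rightarrow> real \<Rightarrow> real \<Rightarrow> real" where
  "coord_z n m v = 1 / (n + m) *
     (LBINT t=0..v. 1 / sqrt (1 - (2 * sqrt (m * n) / (n + m))\<^sup>2 * (sin t)\<^sup>2))"

definition coord_y :: "real \<Rightarrow> real \<Rightarrow> real \<Rightarrow> real" where
  "coord_y n m v = 2 * coord_z n m v + 1 / n * ellK (m / n)"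

end

theory Submission
  imports Defs
begin

text \<open>Substituting \<open>W = 1 / \<sigma>\<^sup>2\<close> turns the Weierstrass equation with a double pole at \<open>0\<close> into
  \<open>\<sigma>'\<^sup>2 = 1 - g\<^sub>2/4 \<sigma>\<^sup>4 - g\<^sub>3/4 \<sigma>\<^sup>6\<close>, which is solved by inverting a primitive of
  \<open>1 / sqrt (1 - g\<^sub>2/4 s\<^sup>4 - g\<^sub>3/4 s\<^sup>6)\<close>. This gives a unique local solution; the duplication formula
  extends it to a meromorphic function on the plane. The same uniqueness argument applies to a
  solution given parametrically as \<open>(Y(\<tau>), W(\<tau>))\<close>, and the identity theorem continues
  \<open>\<wp>(Y(\<tau>)) = W(\<tau>)\<close> along a strip around the real axis. With \<open>Y\<close> an elliptic integral of the
  first kind, this evaluates \<open>\<phi>\<^sub>0, \<phi>\<^sub>1, \<phi>\<^sub>2\<close> as \<open>- c sin \<theta>\<close>, \<open>cos \<theta> / sqrt 2\<close> and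
  \<open>sqrt (n\<^sup>2 - m\<^sup>2 sin\<^sup>2 \<theta>) / (sqrt 2 n)\<close> in terms of the amplitude \<open>\<theta>\<close>. Landen's transformation
  relates \<open>\<theta>\<close> to the coordinate \<open>v\<close> and produces the components of \<open>I \<and> I\<^sup>*\<close>.\<close>

section \<open>The Weierstrass function\<close>

text \<open>Each formula is easy to solve for \<wp>, not for its argument. Equating
  \<open>phi0\<close>, \<open>phi1\<close>, \<open>phi2\<close> with the expected trigonometric
  values gives an explicit \<open>W\<close> in sines, cosines and at most one square root of the
  amplitude, while y is only an elliptic integral of that amplitude. Keeping the amplitude as
  parameter leaves one algebraic identity per function, \<open>W'\<^sup>2 = Y'\<^sup>2 (4 W\<^sup>3
  - g\<^sub>2 W - g\<^sub>3)\<close>, and no elliptic function has to be inverted. The real axis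
  alone would not do: the double poles of \<open>W\<close> cut it into intervals, and uniqueness
  near 0 does not pass from one interval to the next. In a thin strip the radicand has positive real
  part, so its principal root and \<open>Y\<close> are holomorphic, and the strip minus the poles is
  connected. The three functions have different invariants and hence different \<open>W\<close>, but
  all use the same amplitude, shifted by pi/2 for \<open>phi0\<close> and \<open>phi2\<close> and by
  pi for \<open>phi1\<close>, so that the parameter vanishes at the pole of \<wp> at the
  origin.\<close>

lemma eventually_at_imp_eventually_nhds:
  fixes a :: "'a :: t1_space"
  assumes "eventually P (at a)"
  shows "\<forall>\<^sub>F z in at a. eventually P (nhds z)"
proof -
  obtain S where S: "open S" "a \<in> S" "\<And>x. x \<in> S \<Longrightarrow> x \<noteq> a \<Longrightarrow> P x"
    using assms unfolding eventually_at_topological by blast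
  have "open (S - {a})" using S(1) by (rule open_Diff) simp
  then have "eventually P (nhds z)" if "z \<in> S" "z \<noteq> a" for z
    unfolding eventually_nhds using S(3) that by (intro exI[of _ "S - {a}"]) auto
  then show ?thesis unfolding eventually_at_topological using S(1,2) by blast
qed

text \<open>With \<open>W = 1 / s\<^sup>2\<close> the integral of
  \<open>dW / sqrt (4 W\<^sup>3 - g2 W - g3)\<close> becomes, up to sign, that of
  \<open>ds / sqrt (A s)\<close>, which is regular at \<open>s = 0\<close>. Its derivative there is
  1, whence injectivity nearby; positivity of \<open>Re (A s)\<close> keeps the principal root
  holomorphic and nonzero.\<close>

lemma weierstrass_uniformizer:
  fixes g2 g3 :: complex
  defines "A \<equiv> \<lambda>s. 1 - g2 / 4 * s ^ 4 - g3 / 4 * s ^ 6"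
  obtains F e where "e > 0" "F 0 = 0" "inj_on F (ball 0 e)"
    "\<And>s. s \<in> ball 0 e \<Longrightarrow> Re (A s) > 0"
    "\<And>s. s \<in> ball 0 e \<Longrightarrow> (F has_field_derivative 1 / csqrt (A s)) (at s)"
proof -
  have "open {s. Re (A s) > 0}"
    unfolding A_def by (intro open_Collect_less continuous_intros)
  moreover have "0 \<in> {s. Re (A s) > 0}" by (simp add: A_def)
  ultimately obtain d where d: "d > 0" "ball 0 d \<subseteq> {s. Re (A s) > 0}"
    by (meson openE)
  have nz: "A s \<notin> \<real>\<^sub>\<le>\<^sub>0" "A s \<noteq> 0" if "s \<in> ball 0 d" for s
    using d(2) that by (auto simp: complex_nonpos_Reals_iff)
  have "(\<lambda>s. 1 / csqrt (A s)) holomorphic_on ball 0 d"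
    by (intro holomorphic_intros) (use nz in \<open>auto simp: A_def intro!: holomorphic_intros\<close>)
  then obtain G where G: "(G has_field_derivative 1 / csqrt (A s)) (at s within ball 0 d)"
    if "s \<in> ball 0 d" for s
    using holomorphic_convex_primitive'[of "ball 0 d"] by auto
  define F where "F = (\<lambda>s. G s - G 0)"
  have F: "(F has_field_derivative 1 / csqrt (A s)) (at s)" if "s \<in> ball 0 d" for s
    unfolding F_def using G[OF that] that
    by (auto intro!: derivative_eq_intros simp: at_within_open[OF that])
  have hol: "F holomorphic_on ball 0 d"
    using F unfolding holomorphic_on_open[OF open_ball] by blast
  have nz: "deriv F 0 \<noteq> 0"
    using F[of 0] d by (simp add: DERIV_imp_deriv A_def)
  obtain e where e: "e > 0" "ball (0::complex) e \<subseteq> ball 0 d" "inj_on F (ball 0 e)"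
    by (rule has_complex_derivative_locally_injective[OF hol _ open_ball nz]) (use d that in auto)
  show ?thesis
    by (rule that[of e F]) (use e d F in \<open>auto simp: F_def\<close>)
qed

text \<open>For a branch \<open>\<sigma>\<close> of \<open>W\<close> to the power -1/2 the equation
  reads \<open>\<sigma>'\<^sup>2 = Y'\<^sup>2 A(\<sigma>)\<close>. Extracting the root separates the
  variables, and integration from 0 gives \<open>F (\<sigma>) = Y\<close>.\<close>

lemma weierstrass_ode_parametric:
  fixes g2 g3 :: complex
  defines "A \<equiv> \<lambda>s. 1 - g2 / 4 * s ^ 4 - g3 / 4 * s ^ 6"
  assumes F: "e > 0" "F 0 = 0"
    "\<And>s. s \<in> ball 0 e \<Longrightarrow> Re (A s) > 0"
    "\<And>s. s \<in> ball 0 e \<Longrightarrow> (F has_field_derivative 1 / csqrt (A s)) (at s)"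
  assumes Y: "Y analytic_on {0}" "Y 0 = 0" "deriv Y 0 \<noteq> 0"
    and W: "W meromorphic_on {0}" "((\<lambda>z. (Y z)\<^sup>2 * W z) \<longlongrightarrow> 1) (at 0)"
    and ode: "\<forall>\<^sub>F z in at 0. (deriv W z)\<^sup>2 = (deriv Y z)\<^sup>2 * (4 * W z ^ 3 - g2 * W z - g3)"
  shows "\<exists>\<sigma>. \<forall>\<^sub>F z in at 0. \<sigma> z \<in> ball 0 e \<and> F (\<sigma> z) = Y z \<and> W z = 1 / (\<sigma> z)\<^sup>2"
proof -
  define U where "U = (\<lambda>z. if z = 0 then 1 else (Y z)\<^sup>2 * W z)"
  have "(\<lambda>z. (Y z)\<^sup>2 * W z) meromorphic_on {0}"
    by (intro meromorphic_intros analytic_on_imp_meromorphic_on Y W)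
  then have "isolated_singularity_at (\<lambda>z. (Y z)\<^sup>2 * W z) 0"
    by (simp add: meromorphic_at_iff)
  from removable_singularity'[OF this W(2)] have U: "U analytic_on {0}"
    by (simp add: U_def)
  have U0: "U 0 = 1" by (simp add: U_def)
  have "isCont U 0" using U by (rule analytic_at_imp_isCont)
  then have "\<forall>\<^sub>F z in at 0. U z \<in> {u. Re u > 0}"
    unfolding isCont_def U0 by (rule topological_tendstoD) (auto intro: open_halfspace_Re_gt)
  then have Upos: "\<forall>\<^sub>F z in nhds 0. Re (U z) > 0"
    by (auto simp: eventually_nhds_conv_at U0)
  \<comment> \<open>Since \<open>U = Y\<^sup>2 W\<close> tends to 1, its principal root is
    holomorphic near 0. The quotient is therefore the holomorphic branch of \<open>W\<close> to the
    power -1/2 that has the same derivative as \<open>Y\<close> at 0.\<close>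
  define \<sigma> where "\<sigma> = (\<lambda>z. Y z / csqrt (U z))"
  have \<sigma>: "\<sigma> analytic_on {0}"
    unfolding \<sigma>_def
    by (intro analytic_intros Y U) (auto simp: U0)
  have \<sigma>0: "\<sigma> 0 = 0" by (simp add: \<sigma>_def Y)
  have near: "\<forall>\<^sub>F z in nhds 0. \<sigma> z \<in> ball 0 e"
  proof -
    have "isCont \<sigma> 0" using \<sigma> by (rule analytic_at_imp_isCont)
    then have "\<forall>\<^sub>F z in at 0. \<sigma> z \<in> ball 0 e"
      unfolding isCont_def \<sigma>0 by (rule topological_tendstoD) (use F in auto)
    then show ?thesis using F by (auto simp: eventually_nhds_conv_at \<sigma>0)
  qed
  have W\<sigma>: "\<forall>\<^sub>F z in at 0. W z * (\<sigma> z)\<^sup>2 = 1"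
    using eventually_nhds_conv_at[THEN iffD1, OF Upos, THEN conjunct1] eventually_neq_at_within[of 0 0 UNIV]
  proof eventually_elim
    case (elim z)
    then have "U z \<noteq> 0" by auto
    then show ?case using elim by (simp add: \<sigma>_def U_def power_divide field_simps)
  qed
  have an\<sigma>: "\<forall>\<^sub>F z in nhds 0. \<sigma> analytic_on {z}" and anY: "\<forall>\<^sub>F z in nhds 0. Y analytic_on {z}"
    using \<sigma> Y(1) by (auto simp: eventually_nhds_conv_at isolated_singularity_at_altdef[symmetric] isolated_singularity_at_analytic)
  have sq: "\<forall>\<^sub>F z in at 0. (deriv \<sigma> z)\<^sup>2 = (deriv Y z)\<^sup>2 * A (\<sigma> z)"
    using eventually_at_imp_eventually_nhds[OF W\<sigma>] W\<sigma> ode an\<sigma>[unfolded eventually_nhds_conv_at, THEN conjunct1]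
  proof eventually_elim
    case (elim z)
    have s: "\<sigma> z \<noteq> 0" using elim(2) by auto
    \<comment> \<open>Differentiation at \<open>z\<close> needs the identity on a full neighbourhood
      of \<open>z\<close>; one valid off 0 provides this at every nearby \<open>z\<close> other than
      0.\<close>
    have "\<forall>\<^sub>F w in nhds z. W w = 1 / (\<sigma> w)\<^sup>2"
      using elim(1)
    proof eventually_elim
      case (elim w)
      then have "\<sigma> w \<noteq> 0" by auto
      with elim show ?case by (simp add: field_simps)
    qed
    then have "deriv W z = deriv (\<lambda>w. 1 / (\<sigma> w)\<^sup>2) z"
      by (rule deriv_cong_ev) auto
    also have "\<dots> = - 2 * deriv \<sigma> z / \<sigma> z ^ 3"
      using elim(4) s
      by (intro DERIV_imp_deriv)
         (auto intro!: derivative_eq_intros analytic_derivI simp: field_simps eval_nat_numeral)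
    finally have dW: "deriv W z = - 2 * deriv \<sigma> z / \<sigma> z ^ 3" .
    have Wz: "W z = 1 / (\<sigma> z)\<^sup>2" using elim(2) s by (auto simp: field_simps)
    have "(- 2 * deriv \<sigma> z / \<sigma> z ^ 3)\<^sup>2 =
        (deriv Y z)\<^sup>2 * (4 * (1 / (\<sigma> z)\<^sup>2) ^ 3 - g2 * (1 / (\<sigma> z)\<^sup>2) - g3)"
      using elim(3) unfolding dW Wz .
    also have "(- 2 * deriv \<sigma> z / \<sigma> z ^ 3)\<^sup>2 = 4 * (deriv \<sigma> z)\<^sup>2 / \<sigma> z ^ 6"
      by (simp add: power_divide power_mult_distrib flip: power_mult)
    finally have "4 * (deriv \<sigma> z)\<^sup>2 / \<sigma> z ^ 6 =
        (deriv Y z)\<^sup>2 * (4 * (1 / (\<sigma> z)\<^sup>2) ^ 3 - g2 * (1 / (\<sigma> z)\<^sup>2) - g3)" .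
    moreover have "a = b * (X * s ^ 6) / 4" if "4 * a / s ^ 6 = b * X" "s \<noteq> 0" for a b X s :: complex
      using that by (simp add: field_simps)
    ultimately have "(deriv \<sigma> z)\<^sup>2 = (deriv Y z)\<^sup>2 *
        ((4 * (1 / (\<sigma> z)\<^sup>2) ^ 3 - g2 * (1 / (\<sigma> z)\<^sup>2) - g3) * \<sigma> z ^ 6) / 4"
      using s by blast
    also have "(4 * (1 / (\<sigma> z)\<^sup>2) ^ 3 - g2 * (1 / (\<sigma> z)\<^sup>2) - g3) * \<sigma> z ^ 6 = 4 * A (\<sigma> z)"
      unfolding A_def using s by (simp add: field_simps eval_nat_numeral)
    finally show ?case by simp
  qed
  define B where "B = (\<lambda>z. csqrt (A (\<sigma> z)))"
  have A0: "A (\<sigma> 0) = 1" by (simp add: A_def \<sigma>0)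
  have B: "B analytic_on {0}"
    unfolding B_def A_def by (intro analytic_intros \<sigma>) (auto simp: \<sigma>0)
  have B0: "B 0 = 1" by (simp add: B_def A0)
  have Bnz: "\<forall>\<^sub>F z in nhds 0. B z \<noteq> 0"
    using near
  proof eventually_elim
    case (elim z) then show ?case using F(3)[of "\<sigma> z"] by (auto simp: B_def)
  qed
  have d\<sigma>0: "deriv \<sigma> 0 = deriv Y 0"
  proof -
    have "(\<sigma> has_field_derivative deriv Y 0) (at 0)"
      unfolding \<sigma>_def using Y
      by (auto intro!: derivative_eq_intros analytic_derivI U simp: U0)
    then show ?thesis by (rule DERIV_imp_deriv)
  qed
  \<comment> \<open>The two square roots agree in sign because they agree at \<open>0\<close>.\<close>
  have dsum: "\<forall>\<^sub>F z in nhds 0. deriv \<sigma> z / B z + deriv Y z \<noteq> 0"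
  proof -
    have "(\<lambda>z. deriv \<sigma> z / B z + deriv Y z) analytic_on {0}"
      by (intro analytic_intros \<sigma> Y B) (auto simp: B0)
    then have "isCont (\<lambda>z. deriv \<sigma> z / B z + deriv Y z) 0" by (rule analytic_at_imp_isCont)
    then have "\<forall>\<^sub>F z in at 0. deriv \<sigma> z / B z + deriv Y z \<noteq> 0"
      unfolding isCont_def by (rule tendsto_imp_eventually_ne) (use Y in \<open>simp add: B0 d\<sigma>0\<close>)
    then show ?thesis using Y by (auto simp: eventually_nhds_conv_at B0 d\<sigma>0)
  qed
  have d\<sigma>: "\<forall>\<^sub>F z in nhds 0. deriv \<sigma> z / B z = deriv Y z"
    unfolding eventually_nhds_conv_at
  proof
    show "\<forall>\<^sub>F z in at 0. deriv \<sigma> z / B z = deriv Y z"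
      using sq dsum[unfolded eventually_nhds_conv_at, THEN conjunct1]
        Bnz[unfolded eventually_nhds_conv_at, THEN conjunct1]
    proof eventually_elim
      case (elim z)
      have "(deriv \<sigma> z / B z + deriv Y z) * (deriv \<sigma> z / B z - deriv Y z) =
            ((deriv \<sigma> z)\<^sup>2 - (deriv Y z)\<^sup>2 * (B z)\<^sup>2) / (B z)\<^sup>2"
        using elim by (simp add: field_simps power2_eq_square)
      also have "\<dots> = 0" using elim(1) by (simp add: B_def)
      finally show ?case using elim by auto
    qed
  qed (simp add: B0 d\<sigma>0)
  obtain \<delta> where \<delta>: "\<delta> > 0" "\<And>z. z \<in> ball 0 \<delta> \<Longrightarrow> \<sigma> z \<in> ball 0 e \<and> \<sigma> analytic_on {z} \<and>
      Y analytic_on {z} \<and> deriv \<sigma> z / B z = deriv Y z"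
    using eventually_conj[OF near eventually_conj[OF an\<sigma> eventually_conj[OF anY d\<sigma>]]]
    unfolding eventually_nhds_metric by (auto simp: dist_commute)
  have "F (\<sigma> z) - Y z = F (\<sigma> 0) - Y 0" if z: "z \<in> ball 0 \<delta>" for z
  proof (rule has_field_derivative_zero_constant[of "ball 0 \<delta>" "\<lambda>z. F (\<sigma> z) - Y z", THEN exE])
    fix w :: complex assume w: "w \<in> ball 0 \<delta>"
    have "((\<lambda>z. F (\<sigma> z)) has_field_derivative (1 / csqrt (A (\<sigma> w))) * deriv \<sigma> w) (at w)"
      by (rule DERIV_chain2[OF F(4)]) (use \<delta>(2)[OF w] in \<open>auto intro: analytic_derivI\<close>)
    then have "((\<lambda>z. F (\<sigma> z) - Y z) has_field_derivative 0) (at w)"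
      using \<delta>(2)[OF w] by (auto intro!: derivative_eq_intros analytic_derivI simp: B_def)
    then show "((\<lambda>z. F (\<sigma> z) - Y z) has_field_derivative 0) (at w within ball 0 \<delta>)"
      by (rule has_field_derivative_at_within)
  next
    fix c assume c: "\<forall>w\<in>ball 0 \<delta>. F (\<sigma> w) - Y w = c"
    show ?thesis using c[rule_format, OF z] c[rule_format, of 0] \<delta>(1) by simp
  qed simp
  then have FY: "\<forall>\<^sub>F z in nhds 0. F (\<sigma> z) = Y z"
    using \<delta>(1) unfolding eventually_nhds_metric
    by (auto simp: \<sigma>0 Y F dist_commute intro!: exI[of _ \<delta>])
  have "\<forall>\<^sub>F z in at 0. \<sigma> z \<in> ball 0 e \<and> F (\<sigma> z) = Y z \<and> W z = 1 / (\<sigma> z)\<^sup>2"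
    using W\<sigma> FY[unfolded eventually_nhds_conv_at, THEN conjunct1]
      near[unfolded eventually_nhds_conv_at, THEN conjunct1]
  proof eventually_elim
    case (elim z)
    have "\<sigma> z \<noteq> 0" using elim by auto
    then show ?case using elim by (auto simp: field_simps)
  qed
  then show ?thesis by blast
qed

lemma meromorphic_on_imp_eventually_analytic:
  "f meromorphic_on S \<Longrightarrow> z \<in> S \<Longrightarrow> \<forall>\<^sub>F w in at z. f analytic_on {w}"
  by (metis meromorphic_on_altdef isolated_singularity_at_altdef)

text \<open>The solution is \<open>1 / \<eta>\<^sup>2\<close> for the inverse \<open>\<eta>\<close>
  of the integral \<open>F\<close>, and \<open>F (\<sigma>) = Y\<close> forces
  \<open>\<sigma> = \<eta> (Y)\<close>. The last clause quantifies over \<open>Y\<close>: the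
  identity parameter gives ordinary uniqueness, an elliptic integral gives the evaluation of \<wp>.
  It is packed with existence so that both uses refer to one and the same \<open>P\<close>.\<close>

lemma local_weierstrass:
  fixes g2 g3 :: complex
  obtains P where "P meromorphic_on {0}" "((\<lambda>z. z\<^sup>2 * P z) \<longlongrightarrow> 1) (at 0)"
    "\<forall>\<^sub>F z in at 0. (deriv P z)\<^sup>2 = 4 * P z ^ 3 - g2 * P z - g3"
    "\<And>W Y. \<lbrakk>Y analytic_on {0}; Y 0 = 0; deriv Y 0 \<noteq> 0; W meromorphic_on {0};
        ((\<lambda>z. (Y z)\<^sup>2 * W z) \<longlongrightarrow> 1) (at 0);
        \<forall>\<^sub>F z in at 0. (deriv W z)\<^sup>2 = (deriv Y z)\<^sup>2 * (4 * W z ^ 3 - g2 * W z - g3)\<rbrakk>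
      \<Longrightarrow> \<forall>\<^sub>F z in at 0. W z = P (Y z)"
proof -
  define A where "A = (\<lambda>s. 1 - g2 / 4 * s ^ 4 - g3 / 4 * s ^ 6)"
  obtain F e where F: "e > 0" "F 0 = 0" "inj_on F (ball 0 e)"
    "\<And>s. s \<in> ball 0 e \<Longrightarrow> Re (A s) > 0"
    "\<And>s. s \<in> ball 0 e \<Longrightarrow> (F has_field_derivative 1 / csqrt (A s)) (at s)"
    by (rule weierstrass_uniformizer[of g2 g3]) (rule that; simp add: A_def)
  have hol: "F holomorphic_on ball 0 e"
    using F(5) unfolding holomorphic_on_open[OF open_ball] by blast
  obtain \<eta> where \<eta>: "\<eta> holomorphic_on (F ` ball 0 e)"
      "\<And>z. z \<in> ball 0 e \<Longrightarrow> deriv F z * deriv \<eta> (F z) = 1" 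
      "\<And>z. z \<in> ball 0 e \<Longrightarrow> \<eta> (F z) = z"
    using holomorphic_has_inverse[OF hol open_ball F(3)] by blast
  have op: "open (F ` ball 0 e)" by (rule open_mapping_thm3[OF hol open_ball F(3)])
  have in0: "0 \<in> F ` ball 0 e" using F(1,2) by force
  have \<eta>an: "\<eta> analytic_on F ` ball 0 e" using \<eta>(1) op by (simp add: analytic_on_open)
  have \<eta>0: "\<eta> 0 = 0" using \<eta>(3)[of 0] F(1,2) by simp
  have d\<eta>: "deriv \<eta> (F z) = csqrt (A z)" if "z \<in> ball 0 e" for z
    using \<eta>(2)[OF that] DERIV_imp_deriv[OF F(5)[OF that]] F(4)[OF that] by (auto simp: field_simps)
  have d\<eta>0: "deriv \<eta> 0 = 1" using d\<eta>[of 0] F(1,2) by (simp add: A_def)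
  define P where "P = (\<lambda>w. 1 / (\<eta> w)\<^sup>2)"
  have mero: "P meromorphic_on {0}"
    unfolding P_def
    by (intro meromorphic_intros analytic_on_imp_meromorphic_on analytic_on_subset[OF \<eta>an])
      (use in0 in auto)
  have lim: "((\<lambda>z. z\<^sup>2 * P z) \<longlongrightarrow> 1) (at 0)"
  proof -
    have "(\<eta> has_field_derivative 1) (at 0)"
      using analytic_derivI[of \<eta> 0] analytic_on_subset[OF \<eta>an] in0 d\<eta>0 by auto
    then have "((\<lambda>z. \<eta> z / z) \<longlongrightarrow> 1) (at 0)"
      unfolding DERIV_def by (simp add: \<eta>0)
    then have "((\<lambda>z. 1 / (\<eta> z / z)\<^sup>2) \<longlongrightarrow> 1 / 1\<^sup>2) (at 0)"
      by (intro tendsto_intros) auto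
    then show ?thesis by (simp add: P_def power_divide)
  qed
  have ode: "\<forall>\<^sub>F z in at 0. (deriv P z)\<^sup>2 = 4 * P z ^ 3 - g2 * P z - g3"
  proof -
    have "\<forall>\<^sub>F w in at 0. w \<in> F ` ball 0 e - {0}"
      by (rule eventually_at_in_open) (use op in0 in auto)
    then show ?thesis
    proof eventually_elim
      case (elim w)
      then obtain z where z: "z \<in> ball 0 e" "w = F z" by auto
      have nz: "z \<noteq> 0" using z elim F(2) by auto
      have an: "\<eta> analytic_on {w}" using analytic_on_subset[OF \<eta>an] z by auto
      have "(\<eta> has_field_derivative csqrt (A z)) (at w)"
        using analytic_derivI[OF an] d\<eta>[OF z(1)] z by simp
      then have "(P has_field_derivative (- 2 * csqrt (A z) / z ^ 3)) (at w)"
        unfolding P_def using nz \<eta>(3)[OF z(1)] z(2)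
        by (auto intro!: derivative_eq_intros simp: field_simps eval_nat_numeral)
      then have "deriv P w = - 2 * csqrt (A z) / z ^ 3" by (rule DERIV_imp_deriv)
      then have "(deriv P w)\<^sup>2 = 4 * A z / z ^ 6"
        by (simp add: power_divide power_mult_distrib flip: power_mult)
      also have "\<dots> = 4 * P w ^ 3 - g2 * P w - g3"
        using nz \<eta>(3)[OF z(1)] z(2) by (simp add: P_def A_def field_simps eval_nat_numeral)
      finally show ?case .
    qed
  qed
  show ?thesis
  proof (rule that[OF mero lim ode])
    fix W Y
    assume Y: "Y analytic_on {0}" "Y 0 = 0" "deriv Y 0 \<noteq> 0"
    and W: "W meromorphic_on {0}" "((\<lambda>z. (Y z)\<^sup>2 * W z) \<longlongrightarrow> 1) (at 0)"
    and ode: "\<forall>\<^sub>F z in at 0. (deriv W z)\<^sup>2 = (deriv Y z)\<^sup>2 * (4 * W z ^ 3 - g2 * W z - g3)"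
    obtain \<sigma> where \<sigma>: "\<forall>\<^sub>F z in at 0. \<sigma> z \<in> ball 0 e \<and> F (\<sigma> z) = Y z \<and> W z = 1 / (\<sigma> z)\<^sup>2"
      using weierstrass_ode_parametric[OF F(1,2) F(4,5)[unfolded A_def] Y W ode] by blast
    then show "\<forall>\<^sub>F z in at 0. W z = P (Y z)"
    proof eventually_elim
      case (elim z)
      then show ?case using \<eta>(3)[of "\<sigma> z"] by (auto simp: P_def)
    qed
  qed
qed

section \<open>Uniqueness and continuation along a parameter\<close>

lemma meromorphic_eq_from_germ:
  assumes mero: "f meromorphic_on S" "g meromorphic_on S" and S: "open S" "connected S"
    and a: "a \<in> S" "\<forall>\<^sub>F z in at a. f z = g z"
    and b: "b \<in> S"
  shows "\<forall>\<^sub>F z in at b. f z = g z"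
proof -
  have "(\<lambda>z. f z - g z) meromorphic_on S" by (intro meromorphic_intros mero)
  from meromorphic_imp_constant_or_avoid[OF this S, of 0]
  show ?thesis
  proof
    assume "\<forall>\<^sub>\<approx>z\<in>S. f z - g z = 0"
    then show ?thesis using b by (auto simp: eventually_cosparse_open_eq S)
  next
    assume "\<forall>\<^sub>\<approx>z\<in>S. f z - g z \<noteq> 0"
    then have "\<forall>\<^sub>F z in at a. f z - g z \<noteq> 0" using a by (auto simp: eventually_cosparse_open_eq S)
    with a(2) have "\<forall>\<^sub>F z in at a. False" by eventually_elim auto
    then show ?thesis by simp
  qed
qed

text \<open>Both sides are compared with an anonymous local solution \<open>Q\<close>:
  \<open>P\<close> through the identity parameter, \<open>W\<close> through \<open>Y\<close>.
  Agreement near 0 then spreads over \<open>S\<close> by the identity theorem, so the differential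
  equation for \<open>W\<close> has to be checked only near 0. The conclusion concerns punctured
  neighbourhoods because \<open>W\<close> obeys no convention for its values at poles.\<close>

lemma weierstrass_param:
  assumes P: "is_weierstrass g2 g3 P"
    and S: "open S" "connected S" "0 \<in> S"
    and Y: "Y holomorphic_on S" "Y 0 = 0" "deriv Y 0 \<noteq> 0"
    and W: "W meromorphic_on S" "((\<lambda>z. (Y z)\<^sup>2 * W z) \<longlongrightarrow> 1) (at 0)"
    and ode: "\<forall>\<^sub>F z in at 0. (deriv W z)\<^sup>2 = (deriv Y z)\<^sup>2 * (4 * W z ^ 3 - g2 * W z - g3)"
    and b: "b \<in> S"
  shows "\<forall>\<^sub>F z in at b. P (Y z) = W z"
proof -
  obtain Q where Q: 
    "\<And>W Y. \<lbrakk>Y analytic_on {0}; Y 0 = 0; deriv Y 0 \<noteq> 0; W meromorphic_on {0};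
        ((\<lambda>z. (Y z)\<^sup>2 * W z) \<longlongrightarrow> 1) (at 0);
        \<forall>\<^sub>F z in at 0. (deriv W z)\<^sup>2 = (deriv Y z)\<^sup>2 * (4 * W z ^ 3 - g2 * W z - g3)\<rbrakk>
      \<Longrightarrow> \<forall>\<^sub>F z in at 0. W z = Q (Y z)"
    by (rule local_weierstrass[of g2 g3]) (rule that)
  have Pm: "P meromorphic_on UNIV" using P by (auto simp: is_weierstrass_def nicely_meromorphic_on_def)
  have PQ: "\<forall>\<^sub>F z in at 0. P z = Q z"
  proof (rule Q)
    show "P meromorphic_on {0}" using Pm by (rule meromorphic_on_subset) auto
    show "(\<lambda>z. z\<^sup>2 * P z) \<midarrow>0\<rightarrow> 1" using P by (simp add: is_weierstrass_def)
    have "\<forall>\<^sub>F z in at 0. P analytic_on {z}"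
      using meromorphic_on_imp_eventually_analytic[OF Pm] by simp
    then show "\<forall>\<^sub>F z in at 0. (deriv P z)\<^sup>2 =
        (deriv (\<lambda>a. a) z)\<^sup>2 * (4 * P z ^ 3 - g2 * P z - g3)"
    proof eventually_elim
      case (elim z)
      then have "\<not> is_pole P z" by (rule analytic_at_imp_no_pole)
      then show ?case using P by (simp add: is_weierstrass_def)
    qed
  qed (auto simp: analytic_on_ident)
  have Yan: "Y analytic_on S" using Y(1) S(1) by (simp add: analytic_on_open)
  have Y0: "Y analytic_on {0}" using analytic_on_subset[OF Yan] S(3) by auto
  have WQ: "\<forall>\<^sub>F z in at 0. W z = Q (Y z)"
    by (rule Q[OF Y0 Y(2,3) meromorphic_on_subset[OF W(1)] W(2) ode]) (use S in auto)
  have "\<forall>\<^sub>F z in at 0. Y z \<noteq> 0"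
    using tendsto_imp_eventually_ne[OF W(2) one_neq_zero] by eventually_elim auto
  moreover have "Y \<midarrow>0\<rightarrow> 0"
    using analytic_at_imp_isCont[OF Y0] Y(2) by (simp add: isCont_def)
  ultimately have "filterlim Y (at 0) (at 0)"
    by (auto simp: filterlim_at)
  then have "\<forall>\<^sub>F z in at 0. P (Y z) = Q (Y z)"
    using PQ by (auto simp: filterlim_iff)
  with WQ have 0: "\<forall>\<^sub>F z in at 0. P (Y z) = W z"
    by eventually_elim auto
  show ?thesis
    by (rule meromorphic_eq_from_germ[OF meromorphic_on_compose[OF Pm Yan] W(1) S 0 b]) simp
qed

text \<open>The identity parameter gives agreement on punctured neighbourhoods of every point. A
  nicely meromorphic function is fixed by \<open>remove_sings\<close>, so the values themselves
  agree, at poles as well.\<close>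

lemma is_weierstrass_unique:
  assumes "is_weierstrass g2 g3 P" "is_weierstrass g2 g3 Q"
  shows "P = Q"
proof
  fix b
  have Qm: "Q nicely_meromorphic_on UNIV" "Q meromorphic_on UNIV" and Pm: "P nicely_meromorphic_on UNIV"
    using assms by (auto simp: is_weierstrass_def nicely_meromorphic_on_def)
  have "\<forall>\<^sub>F z in at 0. Q analytic_on {z}"
    using meromorphic_on_imp_eventually_analytic[OF Qm(2)] by simp
  then have ode: "\<forall>\<^sub>F z in at 0. (deriv Q z)\<^sup>2 =
        (deriv (\<lambda>a. a) z)\<^sup>2 * (4 * Q z ^ 3 - g2 * Q z - g3)"
  proof eventually_elim
    case (elim z)
    then have "\<not> is_pole Q z" by (rule analytic_at_imp_no_pole)
    then show ?case using assms by (simp add: is_weierstrass_def)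
  qed
  have ev: "\<forall>\<^sub>F z in at b. P z = Q z"
    by (rule weierstrass_param[OF assms(1), of UNIV "\<lambda>z. z"])
       (use assms Qm ode in \<open>auto simp: is_weierstrass_def\<close>)
  have rem: "remove_sings f b = f b" if "f nicely_meromorphic_on UNIV" for f
    using that unfolding nicely_meromorphic_on_def
    by (metis UNIV_I remove_sings_at_pole remove_sings_eqI)
  show "P b = Q b"
    using remove_sings_cong[OF ev refl] rem[OF Pm] rem[OF Qm(1)] by simp
qed

section \<open>Global existence by duplication\<close>

definition weierstrass_germ :: "complex \<Rightarrow> complex \<Rightarrow> (complex \<Rightarrow> complex) \<Rightarrow> bool" where
  "weierstrass_germ g2 g3 f \<longleftrightarrow> ((\<lambda>z. z\<^sup>2 * f z) \<longlongrightarrow> 1) (at 0) \<and>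
     (\<forall>\<^sub>F z in at 0. (deriv f z)\<^sup>2 = 4 * f z ^ 3 - g2 * f z - g3)"

lemma weierstrass_germ_cong:
  assumes "weierstrass_germ g2 g3 f" "\<forall>\<^sub>F z in at 0. f z = g z"
  shows "weierstrass_germ g2 g3 g"
proof -
  have "\<forall>\<^sub>F z in at 0. z\<^sup>2 * f z = z\<^sup>2 * g z"
    using assms(2) by eventually_elim simp
  then have "((\<lambda>z. z\<^sup>2 * g z) \<longlongrightarrow> 1) (at 0)"
    using assms(1) tendsto_cong[of "\<lambda>z. z\<^sup>2 * f z" "\<lambda>z. z\<^sup>2 * g z"] by (simp add: weierstrass_germ_def)
  moreover have "\<forall>\<^sub>F z in at 0. (deriv f z)\<^sup>2 = 4 * f z ^ 3 - g2 * f z - g3"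
    using assms(1) by (simp add: weierstrass_germ_def)
  then have "\<forall>\<^sub>F z in at 0. (deriv g z)\<^sup>2 = 4 * g z ^ 3 - g2 * g z - g3"
    using eventually_at_imp_eventually_nhds[OF assms(2)] assms(2)
  proof eventually_elim
    case (elim z)
    then show ?case using deriv_cong_ev[OF elim(2) refl] by simp
  qed
  ultimately show ?thesis by (simp add: weierstrass_germ_def)
qed

lemma weierstrass_germ_unique:
  assumes f: "weierstrass_germ g2 g3 f" "f meromorphic_on {0}"
    and g: "weierstrass_germ g2 g3 g" "g meromorphic_on {0}"
  shows "\<forall>\<^sub>F z in at 0. f z = g z"
proof -
  obtain Q where Q: 
    "\<And>W Y. \<lbrakk>Y analytic_on {0}; Y 0 = 0; deriv Y 0 \<noteq> 0; W meromorphic_on {0};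
        ((\<lambda>z. (Y z)\<^sup>2 * W z) \<longlongrightarrow> 1) (at 0);
        \<forall>\<^sub>F z in at 0. (deriv W z)\<^sup>2 = (deriv Y z)\<^sup>2 * (4 * W z ^ 3 - g2 * W z - g3)\<rbrakk>
      \<Longrightarrow> \<forall>\<^sub>F z in at 0. W z = Q (Y z)"
    by (rule local_weierstrass[of g2 g3]) (rule that)
  have "\<forall>\<^sub>F z in at 0. h z = Q z" if "weierstrass_germ g2 g3 h" "h meromorphic_on {0}" for h
    by (rule Q[of "\<lambda>z. z"]) (use that in \<open>auto simp: weierstrass_germ_def\<close>)
  from this[OF f] this[OF g] show ?thesis by eventually_elim simp
qed

text \<open>This is the Weierstrass equation for the quotient in the duplication formula, cleared of
  denominators: \<open>m\<close> is its denominator, \<open>n\<close> is 16 times its numerator so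
  that all coefficients are integral, and the square on the left is that of the numerator of the
  derivative of \<open>n / m\<close>.\<close>

lemma duplication_identity:
  fixes a b x :: "'a :: field_char_0"
  assumes "n = 16 * x ^ 4 + 8 * a * x\<^sup>2 + 32 * b * x + a\<^sup>2" "m = 4 * x ^ 3 - a * x - b"
  shows "((64 * x ^ 3 + 16 * a * x + 32 * b) * m - n * (12 * x\<^sup>2 - a))\<^sup>2 = n ^ 3 - 64 * a * n * m\<^sup>2 - 1024 * b * m ^ 3"
  unfolding assms by algebra

text \<open>\<open>N / M\<close> expresses \<open>\<wp>(2 w)\<close> through
  \<open>\<wp>(w)\<close>. Taken as a definition with \<open>w = z / 2\<close>, it doubles the
  radius of the disc. The degrees of \<open>N\<close> and \<open>M\<close> are 4 and 3 and
  \<open>M\<close> has leading coefficient 4, so \<open>g z\<close> behaves like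
  \<open>f (z / 2) / 4\<close>, which restores the normalisation at 0.\<close>

lemma weierstrass_duplication:
  fixes g2 g3 :: complex
  assumes f: "weierstrass_germ g2 g3 f" "f meromorphic_on ball 0 \<rho>" and \<rho>: "\<rho> > 0"
  shows "\<exists>g. weierstrass_germ g2 g3 g \<and> g meromorphic_on ball 0 (2 * \<rho>)"
proof -
  define N where "N = (\<lambda>x::complex. x ^ 4 + g2 / 2 * x\<^sup>2 + 2 * g3 * x + g2\<^sup>2 / 16)"
  define M where "M = (\<lambda>x::complex. 4 * x ^ 3 - g2 * x - g3)"
  define g where "g = (\<lambda>z. N (f (z / 2)) / M (f (z / 2)))"
  have "(\<lambda>z. f (z / 2)) meromorphic_on ball 0 (2 * \<rho>)"
    by (rule meromorphic_on_compose[OF f(2)]) (auto intro!: analytic_intros)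
  then have mero: "g meromorphic_on ball 0 (2 * \<rho>)"
    unfolding g_def N_def M_def by (intro meromorphic_intros)
  have lim: "((\<lambda>z. z\<^sup>2 * f z) \<longlongrightarrow> 1) (at 0)"
    using f(1) by (simp add: weierstrass_germ_def)
  have half: "filterlim (\<lambda>z::complex. z / 2) (at 0) (at 0)"
    by (auto simp: filterlim_at eventually_at_filter intro!: tendsto_eq_intros)
  have M_lim: "((\<lambda>w. w ^ 6 * M (f w)) \<longlongrightarrow> 4) (at 0)"
  proof -
    have "((\<lambda>w. 4 * (w\<^sup>2 * f w) ^ 3 - g2 * w ^ 4 * (w\<^sup>2 * f w) - g3 * w ^ 6) \<longlongrightarrow>
        4 * 1 ^ 3 - g2 * 0 ^ 4 * 1 - g3 * 0 ^ 6) (at 0)"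
      by (intro tendsto_intros lim)
    then show ?thesis by (simp add: M_def algebra_simps eval_nat_numeral)
  qed
  have N_lim: "((\<lambda>w. w ^ 8 * N (f w)) \<longlongrightarrow> 1) (at 0)"
  proof -
    have "((\<lambda>w. (w\<^sup>2 * f w) ^ 4 + g2 / 2 * w ^ 4 * (w\<^sup>2 * f w)\<^sup>2 + 2 * g3 * w ^ 6 * (w\<^sup>2 * f w)
        + g2\<^sup>2 / 16 * w ^ 8) \<longlongrightarrow>
        1 ^ 4 + g2 / 2 * 0 ^ 4 * 1\<^sup>2 + 2 * g3 * 0 ^ 6 * 1 + g2\<^sup>2 / 16 * 0 ^ 8) (at 0)"
      by (intro tendsto_intros lim)
    then show ?thesis by (simp add: N_def algebra_simps eval_nat_numeral)
  qed
  have Mnz: "\<forall>\<^sub>F w in at 0. M (f w) \<noteq> 0"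
    using tendsto_imp_eventually_ne[OF M_lim, of 0] by (auto elim: eventually_mono)
  \<comment> \<open>For \<open>w = z / 2\<close> one has
    \<open>z\<^sup>2 = 4 w\<^sup>8 / w\<^sup>6\<close>; the exponents are the pole orders of
    \<open>N (f w)\<close> and \<open>M (f w)\<close>.\<close>
  have "((\<lambda>w. 4 * ((w ^ 8 * N (f w)) / (w ^ 6 * M (f w)))) \<longlongrightarrow> 4 * (1 / 4)) (at 0)"
    by (intro tendsto_intros N_lim M_lim) auto
  then have "((\<lambda>z. 4 * (((z / 2) ^ 8 * N (f (z / 2))) / ((z / 2) ^ 6 * M (f (z / 2))))) \<longlongrightarrow> 4 * (1 / 4)) (at 0)"
    by (rule filterlim_compose[OF _ half])
  moreover have "4 * (((z / 2) ^ 8 * N (f (z / 2))) / ((z / 2) ^ 6 * M (f (z / 2)))) = z\<^sup>2 * g z" for z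
    by (cases "z = 0") (auto simp: g_def power_divide eval_nat_numeral)
  ultimately have g_lim: "((\<lambda>z. z\<^sup>2 * g z) \<longlongrightarrow> 1) (at 0)" by simp
  have an: "\<forall>\<^sub>F w in at 0. f analytic_on {w}"
    by (rule meromorphic_on_imp_eventually_analytic[OF f(2)]) (use \<rho> in auto)
  have "\<forall>\<^sub>F w in at 0. f analytic_on {w} \<and> M (f w) \<noteq> 0 \<and> (deriv f w)\<^sup>2 = M (f w)"
    using an Mnz f(1) by (auto simp: weierstrass_germ_def M_def eventually_conj_iff algebra_simps)
  then have "\<forall>\<^sub>F z in at 0. f analytic_on {z / 2} \<and> M (f (z / 2)) \<noteq> 0 \<and> (deriv f (z / 2))\<^sup>2 = M (f (z / 2))"
    using half by (auto simp: filterlim_iff)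
  then have g_ode: "\<forall>\<^sub>F z in at 0. (deriv g z)\<^sup>2 = 4 * g z ^ 3 - g2 * g z - g3"
  proof eventually_elim
    case (elim z)
    define x where "x = f (z / 2)"
    define N' M' where "N' = 4 * x ^ 3 + g2 * x + 2 * g3" and "M' = 12 * x\<^sup>2 - g2"
    have df: "((\<lambda>z. f (z / 2)) has_field_derivative deriv f (z / 2) * (1 / 2)) (at z)"
      by (rule DERIV_chain2[of f]) (use elim in \<open>auto intro!: derivative_eq_intros analytic_derivI\<close>)
    have dN: "((\<lambda>z. N (f (z / 2))) has_field_derivative N' * (deriv f (z / 2) / 2)) (at z)"
      unfolding N_def N'_def x_def
      by (rule derivative_eq_intros df refl)+ (simp add: algebra_simps)
    have dM: "((\<lambda>z. M (f (z / 2))) has_field_derivative M' * (deriv f (z / 2) / 2)) (at z)"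
      unfolding M_def M'_def x_def
      by (rule derivative_eq_intros df refl)+ (simp add: algebra_simps)
    have Mx: "M x \<noteq> 0" using elim by (simp add: x_def)
    have "(g has_field_derivative (N' * (deriv f (z / 2) / 2) * M x - N x * (M' * (deriv f (z / 2) / 2))) / (M x * M x)) (at z)"
      using DERIV_divide[OF dN dM] Mx by (simp add: g_def x_def)
    then have "deriv g z = (N' * M x - N x * M') * deriv f (z / 2) / (2 * (M x)\<^sup>2)"
      using Mx by (simp add: DERIV_imp_deriv field_simps power2_eq_square)
    then have "(deriv g z)\<^sup>2 = (N' * M x - N x * M')\<^sup>2 * (deriv f (z / 2))\<^sup>2 / (4 * (M x) ^ 4)"
      by (simp add: power_divide power_mult_distrib flip: power_mult)
    also have "(deriv f (z / 2))\<^sup>2 = M x" using elim by (simp add: x_def)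
    also have "(N' * M x - N x * M')\<^sup>2 = 4 * (4 * N x ^ 3 - g2 * N x * (M x)\<^sup>2 - g3 * M x ^ 3)"
    proof -
      have N16: "16 * N x = 16 * x ^ 4 + 8 * g2 * x\<^sup>2 + 32 * g3 * x + g2\<^sup>2"
        by (simp add: N_def)
      have N'16: "64 * x ^ 3 + 16 * g2 * x + 32 * g3 = 16 * N'"
        by (simp add: N'_def)
      have "(16 * (N' * M x - N x * M'))\<^sup>2 = (16 * N x) ^ 3 - 64 * g2 * (16 * N x) * (M x)\<^sup>2 - 1024 * g3 * M x ^ 3"
        using duplication_identity[OF N16 fun_cong[OF M_def]]
        unfolding N'16 M'_def[symmetric] by (simp only: right_diff_distrib mult.assoc)
      moreover have "t\<^sup>2 = 4 * (4 * a ^ 3 - b * a * c - d * e)"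
        if "(16 * t)\<^sup>2 = (16 * a) ^ 3 - 64 * b * (16 * a) * c - 1024 * d * e" for t a b c d e :: complex
      proof -
        have "256 * t\<^sup>2 = 256 * (4 * (4 * a ^ 3 - b * a * c - d * e))"
          using that by (simp add: power_mult_distrib algebra_simps)
        then show ?thesis by (subst (asm) mult_cancel_left) simp
      qed
      ultimately show ?thesis by blast
    qed
    also have "4 * (4 * N x ^ 3 - g2 * N x * (M x)\<^sup>2 - g3 * M x ^ 3) * M x / (4 * M x ^ 4)
        = 4 * (N x / M x) ^ 3 - g2 * (N x / M x) - g3"
      using Mx by (simp add: field_simps eval_nat_numeral)
    also have "N x / M x = g z" by (simp add: g_def x_def)
    finally show ?case .
  qed
  show ?thesis using mero g_lim g_ode by (auto simp: weierstrass_germ_def)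
qed

text \<open>Repeated doubling yields a solution on each disc of radius
  \<open>2 ^ k * \<rho>\<close>. These are chosen independently of each other; uniqueness of the
  germ at 0 makes them compatible, so that they glue to a function on the plane.\<close>

lemma is_weierstrass_exists: "\<exists>P. is_weierstrass g2 g3 P"
proof -
  obtain P0 where P0: "P0 meromorphic_on {0}" "weierstrass_germ g2 g3 P0"
  proof (rule local_weierstrass[of g2 g3])
    fix P
    assume "P meromorphic_on {0}" "((\<lambda>z. z\<^sup>2 * P z) \<longlongrightarrow> 1) (at 0)"
      "\<forall>\<^sub>F z in at 0. (deriv P z)\<^sup>2 = 4 * P z ^ 3 - g2 * P z - g3"
    from this(1) conjI[OF this(2,3)] show thesis
      unfolding weierstrass_germ_def[symmetric] by (rule that)
  qed
  obtain V where V: "open V" "{0} \<subseteq> V" "P0 meromorphic_on V"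
    using meromorphic_on_open_nhd[OF P0(1)] by blast
  then obtain \<rho> where \<rho>: "\<rho> > 0" "ball 0 \<rho> \<subseteq> V" by (auto simp: open_contains_ball)
  define B where "B = (\<lambda>k::nat. ball (0::complex) (2 ^ k * \<rho>))"
  have B0: "0 \<in> B k" for k using \<rho> by (simp add: B_def)
  have Bmono: "i \<le> j \<Longrightarrow> B i \<subseteq> B j" for i j
    using \<rho>(1) unfolding B_def by (intro subset_ball mult_right_mono power_increasing) auto
  have Bex: "\<exists>k. z \<in> B k" for z
  proof -
    obtain k where "norm z / \<rho> < 2 ^ k" using real_arch_pow[of 2 "norm z / \<rho>"] by auto
    then show ?thesis using \<rho>(1) by (auto simp: B_def field_simps)
  qed
  have "\<exists>f. weierstrass_germ g2 g3 f \<and> f meromorphic_on B k" for k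
  proof (induction k)
    case 0
    show ?case using P0(2) meromorphic_on_subset[OF V(3) \<rho>(2)] by (auto simp: B_def)
  next
    case (Suc k)
    then show ?case using weierstrass_duplication[of g2 g3 _ "2 ^ k * \<rho>"] \<rho>(1) by (auto simp: B_def mult.assoc)
  qed
  then obtain f where f: "\<And>k. weierstrass_germ g2 g3 (f k)" "\<And>k. f k meromorphic_on B k"
    by metis
  \<comment> \<open>Equal germs give equality only on punctured neighbourhoods. Removing
    singularities normalises the values, so that the pieces agree pointwise.\<close>
  define h where "h = (\<lambda>k. remove_sings (f k))"
  have f_nice: "h k nicely_meromorphic_on B k" for k
    unfolding h_def by (rule remove_sings_nicely_meromorphic[OF f(2)])
  have h_mero: "h k meromorphic_on B k" for k
    using f_nice by (auto simp: nicely_meromorphic_on_def)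
  have h_germ: "weierstrass_germ g2 g3 (h k)" for k
  proof (rule weierstrass_germ_cong[OF f(1)])
    show "\<forall>\<^sub>F z in at 0. f k z = h k z"
      using eventually_remove_sings_eq_at[of "f k" 0] f(2)[of k] B0
      by (auto simp: meromorphic_on_altdef h_def elim: eventually_mono)
  qed
  have h_eq: "h i z = h j z" if "z \<in> B i" "i \<le> j" for i j z
  proof -
    have ev: "\<forall>\<^sub>F w in at z. f i w = f j w"
    proof (rule meromorphic_eq_from_germ[of _ "B i"])
      show "f j meromorphic_on B i" using f(2) Bmono[OF that(2)] by (rule meromorphic_on_subset)
      show "\<forall>\<^sub>F z in at 0. f i z = f j z"
        by (rule weierstrass_germ_unique[OF f(1) _ f(1)])
          (rule meromorphic_on_subset[OF f(2)]; use B0 in blast)+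
    qed (use f(2) B0 that in \<open>auto simp: B_def\<close>)
    show ?thesis unfolding h_def by (rule remove_sings_cong[OF ev refl])
  qed
  define P where "P = (\<lambda>z. h (LEAST k. z \<in> B k) z)"
  have P: "P z = h k z" if "z \<in> B k" for z k
    unfolding P_def by (rule h_eq) (use that in \<open>auto intro: LeastI Least_le\<close>)
  have P_ev: "\<forall>\<^sub>F w in nhds z. P w = h k w" if "z \<in> B k" for z k
    using eventually_nhds_in_open[of "B k" z] that by (auto simp: B_def elim!: eventually_mono intro!: P[unfolded B_def])
  have P_at: "\<forall>\<^sub>F w in at z. P w = h k w" if "z \<in> B k" for z k
    using P_ev[OF that] by (simp add: eventually_nhds_conv_at)
  have mero: "P meromorphic_on UNIV"
    unfolding meromorphic_on_meromorphic_at[of _ UNIV]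
  proof
    fix z obtain k where k: "z \<in> B k" using Bex by blast
    have "h k meromorphic_on {z}" using h_mero[of k] by (rule meromorphic_on_subset) (use k in auto)
    then show "P meromorphic_on {z}"
      using meromorphic_on_cong[of "{z}" P "h k"] P_at[OF k] by auto
  qed
  have "(is_pole P z \<and> P z = 0) \<or> P \<midarrow>z\<rightarrow> P z" for z
  proof -
    obtain k where k: "z \<in> B k" using Bex by blast
    have "(is_pole (h k) z \<and> h k z = 0) \<or> h k \<midarrow>z\<rightarrow> h k z"
      using f_nice[of k] k by (auto simp: nicely_meromorphic_on_def)
    then show ?thesis
      using is_pole_cong[OF P_at[OF k] refl] tendsto_cong[OF P_at[OF k]] P[OF k] by auto
  qed
  with mero have nice: "P nicely_meromorphic_on UNIV" by (auto simp: nicely_meromorphic_on_def)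
  have germ: "weierstrass_germ g2 g3 P"
    by (rule weierstrass_germ_cong[OF h_germ[of 0]]) (use P_at[OF B0, of 0] in \<open>auto elim: eventually_mono\<close>)
  \<comment> \<open>The equation spreads from 0 to a punctured neighbourhood of \<open>z\<close>;
    both sides are continuous at a point where \<open>P\<close> is analytic, so it holds at
    \<open>z\<close> too.\<close>
  have ode: "(deriv P z)\<^sup>2 = 4 * P z ^ 3 - g2 * P z - g3" if "\<not> is_pole P z" for z
  proof -
    have an: "P analytic_on {z}"
      by (rule nicely_meromorphic_on_imp_analytic_at[OF nice _ that]) auto
    have "\<forall>\<^sub>F w in at z. (deriv P w)\<^sup>2 = 4 * P w ^ 3 - g2 * P w - g3"
      by (rule meromorphic_eq_from_germ[of _ UNIV _ 0])
         (use germ in \<open>auto simp: weierstrass_germ_def intro!: meromorphic_intros mero\<close>)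
    moreover have "(\<lambda>w. 4 * P w ^ 3 - g2 * P w - g3) \<midarrow>z\<rightarrow> 4 * P z ^ 3 - g2 * P z - g3"
      by (intro isContD analytic_at_imp_isCont analytic_intros an)
    ultimately have "(\<lambda>w. (deriv P w)\<^sup>2) \<midarrow>z\<rightarrow> 4 * P z ^ 3 - g2 * P z - g3"
      by (subst tendsto_cong)
    moreover have "(\<lambda>w. (deriv P w)\<^sup>2) \<midarrow>z\<rightarrow> (deriv P z)\<^sup>2"
      by (intro isContD analytic_at_imp_isCont analytic_intros an)
    ultimately show ?thesis by (intro LIM_unique)
  qed
  show ?thesis using nice germ ode by (auto simp: is_weierstrass_def weierstrass_germ_def)
qed

lemma is_weierstrass_weierstrass: "is_weierstrass g2 g3 (weierstrass g2 g3)"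
proof -
  have "\<exists>!P. is_weierstrass g2 g3 P"
    using is_weierstrass_exists is_weierstrass_unique by blast
  then show ?thesis unfolding weierstrass_def by (rule theI')
qed

section \<open>Parametric evaluation on the real line\<close>

lemma DERIV_nonzero_imp_eventually_ne:
  fixes f :: "'a :: real_normed_field \<Rightarrow> 'a"
  assumes "(f has_field_derivative D) (at z)" "D \<noteq> 0"
  shows "\<forall>\<^sub>F w in at z. f w \<noteq> f z"
proof -
  have "((\<lambda>w. (f w - f z) / (w - z)) \<longlongrightarrow> D) (at z)"
    using assms(1) by (simp add: has_field_derivative_iff)
  from tendsto_imp_eventually_ne[OF this assms(2)] show ?thesis
    by eventually_elim auto
qed

text \<open>Near every real parameter \<open>P (Y z)\<close> equals \<open>W z\<close>, and
  \<open>Y\<close> is locally injective there, so \<wp> has a pole at \<open>y t\<close> exactly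
  when \<open>W\<close> has one at \<open>t\<close>. The predicate \<open>D\<close> marks these
  parameters; at them the limit of \<open>F\<close> at infinity supplies the value extended by
  continuity.\<close>

lemma wp_extend_param:
  fixes Y W :: "complex \<Rightarrow> complex" and y w \<phi> F :: "real \<Rightarrow> real"
  assumes S: "open S" "connected S" "\<And>t. complex_of_real t \<in> S"
    and Y: "Y holomorphic_on S" "Y 0 = 0" "\<And>z. z \<in> S \<Longrightarrow> deriv Y z \<noteq> 0"
    and y: "\<And>t. Y (of_real t) = of_real (y t)" "strict_mono y" "continuous_on UNIV y"
    and W: "W meromorphic_on S" "((\<lambda>z. (Y z)\<^sup>2 * W z) \<longlongrightarrow> 1) (at 0)"
    and ode: "\<forall>\<^sub>F z in at 0. (deriv W z)\<^sup>2 =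
      (deriv Y z)\<^sup>2 * (4 * W z ^ 3 - of_real g2 * W z - of_real g3)"
    and regular: "\<And>t. \<not> D t \<Longrightarrow> W analytic_on {of_real t}" "\<And>t. \<not> D t \<Longrightarrow> W (of_real t) = of_real (w t)"
      "\<And>t. \<not> D t \<Longrightarrow> F (w t) = \<phi> t"
    and singular: "\<And>t. D t \<Longrightarrow> is_pole W (of_real t)" "\<And>t. D t \<Longrightarrow> (F \<longlongrightarrow> \<phi> t) at_infinity"
  shows "wp_extend F g2 g3 (y t) = \<phi> t"
proof -
  define P where "P = weierstrass (of_real g2) (of_real g3)"
  have isP: "is_weierstrass (of_real g2) (of_real g3) P"
    unfolding P_def by (rule is_weierstrass_weierstrass)
  then have nice: "P nicely_meromorphic_on UNIV" by (simp add: is_weierstrass_def)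
  have S0: "0 \<in> S" using S(3)[of 0] by simp
  have Yan: "Y analytic_on {of_real s}" for s
    using Y(1) S by (auto simp: analytic_at)
  have ev: "\<forall>\<^sub>F z in at (of_real s). P (Y z) = W z" for s
    by (rule weierstrass_param[OF isP S(1,2) S0 Y(1,2) Y(3)[OF S0] W ode S(3)])
  have ne: "\<forall>\<^sub>F z in at (of_real s). Y z \<noteq> Y (of_real s)" for s
    by (rule DERIV_nonzero_imp_eventually_ne[OF analytic_derivI[OF Yan] Y(3)[OF S(3)]])
  have lim: "Y \<midarrow>of_real s\<rightarrow> Y (of_real s)" for s
    by (intro isContD analytic_at_imp_isCont Yan)
  have pole: "is_pole W (of_real s)" if "is_pole P (Y (of_real s))" for s
    using is_pole_compose[OF that lim ne] is_pole_cong[OF ev refl] by simp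
  have not_pole: "P \<midarrow>Y (of_real s)\<rightarrow> P (Y (of_real s))" "W \<midarrow>of_real s\<rightarrow> P (Y (of_real s))"
    if "\<not> is_pole P (Y (of_real s))" for s
  proof -
    have an: "P analytic_on {Y (of_real s)}"
      by (rule nicely_meromorphic_on_imp_analytic_at[OF nice _ that]) auto
    show "P \<midarrow>Y (of_real s)\<rightarrow> P (Y (of_real s))"
      by (intro isContD analytic_at_imp_isCont an)
    have "(\<lambda>z. P (Y z)) \<midarrow>of_real s\<rightarrow> P (Y (of_real s))"
      using analytic_at_imp_isCont[OF an] lim by (rule isCont_tendsto_compose)
    then show "W \<midarrow>of_real s\<rightarrow> P (Y (of_real s))"
      using tendsto_cong[OF ev] by simp
  qed
  have reg: "\<not> is_pole P (Y (of_real s)) \<and> P (Y (of_real s)) = of_real (w s)" if "\<not> D s" for s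
  proof -
    have *: "\<not> is_pole W (of_real s)" using regular(1)[OF that] by (rule analytic_at_imp_no_pole)
    then have np: "\<not> is_pole P (Y (of_real s))" using pole by blast
    have "W \<midarrow>of_real s\<rightarrow> W (of_real s)"
      by (intro isContD analytic_at_imp_isCont regular that)
    then have "P (Y (of_real s)) = W (of_real s)"
      using not_pole(2)[OF np] LIM_unique by blast
    with np regular(2)[OF that] show ?thesis by simp
  qed
  have sing: "is_pole P (Y (of_real s))" if "D s" for s
    using singular(1)[OF that] not_pole(2)[of s] not_tendsto_and_filterlim_at_infinity[of "at (complex_of_real s)" W]
    by (auto simp: is_pole_def)
  show ?thesis
  proof (cases "D t")
    case False
    then have "\<not> wp_pole g2 g3 (y t)" "wp g2 g3 (y t) = w t"
      using reg[OF False] by (simp_all add: wp_pole_def wp_def P_def y)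
    then show ?thesis using regular(3)[OF False] by (simp add: wp_extend_def)
  next
    case True
    \<comment> \<open>That \<wp> is real at these arguments is read off from the real values
      \<open>w\<close>; at a pole the convention for nicely meromorphic functions gives 0. Hence
      passing to real parts does not change the norm, and the blow-up of \<open>P\<close> carries
      over to \<open>wp\<close>.\<close>
    have real: "P (of_real (y s)) = of_real (wp g2 g3 (y s))" for s
    proof (cases "D s")
      case True
      have "P (Y (of_real s)) = 0"
        using sing[OF True] nice not_tendsto_and_filterlim_at_infinity[of "at (Y (of_real s))" P]
        unfolding nicely_meromorphic_on_def is_pole_def by auto
      then show ?thesis by (simp add: wp_def P_def y)
    next
      case False
      then show ?thesis using reg[OF False] by (simp add: wp_def P_def y)
    qed
    \<comment> \<open>The limit at \<open>y t\<close> runs over all nearby reals, while values are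
      known only at points \<open>y s\<close>. Openness of the range makes every nearby real such a
      point.\<close>
    have "open (range y)"
      by (rule injective_into_1d_imp_open_map_UNIV[OF open_UNIV y(3)])
        (use y(2) in \<open>auto simp: strict_mono_eq inj_on_def\<close>)
    then have "\<forall>\<^sub>F s in nhds (y t). s \<in> range y"
      by (rule eventually_nhds_in_open) auto
    then have "\<forall>\<^sub>F s in at (y t). norm (P (of_real s)) = norm (wp g2 g3 s)"
      unfolding eventually_at_filter by eventually_elim (auto simp: real)
    moreover have "filterlim (\<lambda>s. P (of_real s)) at_infinity (at (y t))"
    proof (rule filterlim_compose[of P _ "at (of_real (y t))"])
      show "filterlim P at_infinity (at (of_real (y t)))"
        using sing[OF True] by (simp add: is_pole_def y)
      show "filterlim complex_of_real (at (of_real (y t))) (at (y t))"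
        by (auto simp: filterlim_at eventually_at_filter intro!: tendsto_intros)
    qed
    ultimately have "filterlim (wp g2 g3) at_infinity (at (y t))"
      using filterlim_cong[of at_top at_top "at (y t)" "at (y t)" "\<lambda>s. norm (P (of_real s))" "\<lambda>s. norm (wp g2 g3 s)"]
      unfolding filterlim_at_infinity_conv_norm_at_top by simp
    from filterlim_compose[OF singular(2)[OF True] this]
    have "Lim (at (y t)) (\<lambda>s. F (wp g2 g3 s)) = \<phi> t"
      by (intro tendsto_Lim) auto
    moreover have "wp_pole g2 g3 (y t)"
      using sing[OF True] by (simp add: wp_pole_def P_def y)
    ultimately show ?thesis by (simp add: wp_extend_def)
  qed
qed

text \<open>The shift \<open>h\<close> covers both \<open>cos\<close> and \<open>sin = cos (\<cdot> - pi/2)\<close>.\<close>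

lemma elliptic_integral_extension:
  fixes n m h :: real and y :: "real \<Rightarrow> real"
  assumes nm: "0 < m" "m < n"
    and y: "\<And>t. (y has_real_derivative 1 / sqrt (n\<^sup>2 - m\<^sup>2 * (cos (t + h))\<^sup>2)) (at t)" "y 0 = 0"
  defines "\<Delta> \<equiv> \<lambda>z. (of_real n)\<^sup>2 - (of_real m)\<^sup>2 * (cos (z + of_real h))\<^sup>2 :: complex"
  obtains S Y where "open S" "connected S" "\<And>t. complex_of_real t \<in> S"
    "\<And>z. z \<in> S \<Longrightarrow> Re (\<Delta> z) > 0"
    "\<And>z. z \<in> S \<Longrightarrow> (Y has_field_derivative 1 / csqrt (\<Delta> z)) (at z)"
    "\<And>t. Y (of_real t) = of_real (y t)"
proof -
  \<comment> \<open>\<open>q s\<close> is \<open>m\<^sup>2 cosh\<^sup>2 s\<close>, a bound for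
    \<open>m\<^sup>2 |cos|\<^sup>2\<close> on the horizontal line with imaginary part
    \<open>s\<close>. It is below \<open>n\<^sup>2\<close> at \<open>s = 0\<close>, which determines
    an admissible width of the strip.\<close>
  define q where "q = (\<lambda>s::real. m\<^sup>2 * (1 + (exp s - inverse (exp s))\<^sup>2 / 4))"
  have "isCont q 0" unfolding q_def by (intro continuous_intros) auto
  moreover have "q 0 < n\<^sup>2" using nm by (simp add: q_def power_strict_mono)
  ultimately have "\<forall>\<^sub>F s in nhds 0. q s < n\<^sup>2"
    unfolding isCont_def eventually_nhds_conv_at by (auto dest: order_tendstoD)
  then obtain \<delta> where \<delta>: "\<delta> > 0" "\<And>s. \<bar>s\<bar> < \<delta> \<Longrightarrow> q s < n\<^sup>2"
    by (auto simp: eventually_nhds_metric)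
  define S where "S = {z. Im z < \<delta>} \<inter> {z. Im z > - \<delta>}"
  have S: "open S" "convex S"
    unfolding S_def
    by (intro open_Int convex_Int open_halfspace_Im_lt open_halfspace_Im_gt convex_halfspace_Im_lt
        convex_halfspace_Im_gt)+
  have S_real: "complex_of_real t \<in> S" for t using \<delta>(1) by (simp add: S_def)
  have pos: "Re (\<Delta> z) > 0" if "z \<in> S" for z
  proof -
    have "Re ((of_real m)\<^sup>2 * (cos (z + of_real h))\<^sup>2) \<le> norm ((of_real m)\<^sup>2 * (cos (z + of_real h))\<^sup>2)"
      by (rule complex_Re_le_cmod)
    also have "\<dots> = m\<^sup>2 * norm (cos (z + of_real h)) ^ 2"
      by (simp add: norm_mult norm_power)
    also have "\<dots> \<le> q (Im z)"
      unfolding norm_cos_squared q_def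
      by (intro mult_left_mono add_right_mono) (auto simp: abs_square_le_1)
    also have "\<dots> < n\<^sup>2" using that by (intro \<delta>(2)) (auto simp: S_def)
    finally show ?thesis by (simp add: \<Delta>_def flip: of_real_power)
  qed
  have nz: "\<Delta> z \<notin> \<real>\<^sub>\<le>\<^sub>0" "\<Delta> z \<noteq> 0" if "z \<in> S" for z
    using pos[OF that] by (auto simp: complex_nonpos_Reals_iff)
  have "\<Delta> holomorphic_on S" unfolding \<Delta>_def by (intro holomorphic_intros)
  then have "(\<lambda>z. 1 / csqrt (\<Delta> z)) holomorphic_on S"
    by (intro holomorphic_intros) (use nz in auto)
  then obtain G where G: "\<And>z. z \<in> S \<Longrightarrow> (G has_field_derivative 1 / csqrt (\<Delta> z)) (at z within S)"
    using holomorphic_convex_primitive'[OF S(2,1)] by blast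
  define Y where "Y = (\<lambda>z. G z - G 0)"
  have Y: "(Y has_field_derivative 1 / csqrt (\<Delta> z)) (at z)" if "z \<in> S" for z
  proof -
    have "(G has_field_derivative 1 / csqrt (\<Delta> z)) (at z)"
      using G[OF that] unfolding at_within_open[OF that S(1)] .
    from DERIV_diff[OF this DERIV_const] show ?thesis by (simp add: Y_def)
  qed
  have "((\<lambda>t. Y (of_real t) - of_real (y t)) has_vector_derivative 0) (at t)" for t
  proof -
    have \<Delta>t: "\<Delta> (of_real t) = of_real (n\<^sup>2 - m\<^sup>2 * (cos (t + h))\<^sup>2)"
      by (simp add: \<Delta>_def cos_of_real flip: of_real_add)
    then have "csqrt (\<Delta> (of_real t)) = of_real (sqrt (n\<^sup>2 - m\<^sup>2 * (cos (t + h))\<^sup>2))"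
      using pos[OF S_real[of t]] by (simp only: csqrt_of_real Re_complex_of_real less_imp_le)
    moreover have DY: "((Y \<circ> complex_of_real) has_vector_derivative 1 * (1 / csqrt (\<Delta> (of_real t)))) (at t)"
      by (rule field_vector_diff_chain_at[OF _ Y[OF S_real]])
        (use bounded_linear.has_vector_derivative[OF bounded_linear_of_real has_vector_derivative_id] in simp)
    moreover have Dy: "((\<lambda>t. complex_of_real (y t)) has_vector_derivative
        of_real (1 / sqrt (n\<^sup>2 - m\<^sup>2 * (cos (t + h))\<^sup>2))) (at t)"
      using bounded_linear.has_vector_derivative[OF bounded_linear_of_real
        y(1)[of t, unfolded has_real_derivative_iff_has_vector_derivative]] .
    ultimately show ?thesis
      using has_vector_derivative_diff[OF DY Dy] by (simp add: o_def)
  qed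
  then obtain c where c: "\<And>t. Y (of_real t) - of_real (y t) = c"
    using has_vector_derivative_zero_constant[of UNIV "\<lambda>t. Y (of_real t) - of_real (y t)"] by auto
  have "c = 0" using c[of 0] y(2) by (simp add: Y_def)
  then have "Y (of_real t) = of_real (y t)" for t using c[of t] by simp
  with S S_real pos Y show ?thesis by (intro that[of S Y]) (auto intro: convex_connected)
qed

text \<open>\<open>N\<close> and \<open>M\<close> stand for \<open>n\<^sup>2\<close> and
  \<open>m\<^sup>2\<close>, and \<open>v\<close> is the denominator in \<open>phi0\<close>. In this
  variable the cubic has the root \<open>(N - M) / 2\<close>. For
  \<open>v = (N - M) / (2 sin\<^sup>2 (z / 2))\<close> the linear factor produces
  \<open>cos\<^sup>2 (z / 2)\<close> and the quadratic factor the radicand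
  \<open>N - M cos\<^sup>2 z\<close>, just what the differential equation requires.\<close>

lemma weierstrass_cubic_phi0:
  fixes v N M :: "'a :: field_char_0"
  assumes "v = 2 * W + (N - 5 * M) / 6"
  shows "4 * W ^ 3 - (N * M + (M + N)\<^sup>2 / 12) * W - (- (N * M * (M + N) / 6) + (M + N) ^ 3 / 216)
    = (v - (N - M) / 2) * (v\<^sup>2 + 2 * M * v - M * (N - M)) / 2"
  unfolding assms by (simp add: field_simps) algebra

lemma weierstrass_cubic_phi1:
  fixes v N M :: "'a :: field_char_0"
  assumes "v = 2 * W + (4 * M + N) / 6"
  shows "4 * W ^ 3 - (M * (M - N) + (2 * M - N)\<^sup>2 / 12) * W - (M * (M - N) * (2 * M - N) / 6 - (2 * M - N) ^ 3 / 216)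
    = (v - N / 2) * (v\<^sup>2 - 2 * M * v + M * N) / 2"
  unfolding assms by (simp add: field_simps) algebra

text \<open>For \<open>v = \<rho> (\<epsilon> + \<rho>) / sin\<^sup>2 z\<close> with
  \<open>\<epsilon>\<^sup>2 = N - M cos\<^sup>2 z\<close> and \<open>\<rho>\<^sup>2 = N - M\<close>,
  the root \<open>- M / 2\<close> turns the linear factor into
  \<open>(\<epsilon> + \<rho>)\<^sup>2 / (2 sin\<^sup>2 z)\<close>, and the factor
  \<open>cos\<^sup>2 z\<close> comes from the quadratic.\<close>

lemma weierstrass_cubic_phi2:
  fixes v N M :: "'a :: field_char_0"
  assumes "v = 2 * W + (4 * N - 5 * M) / 6"
  shows "4 * W ^ 3 - (N * (N - M) + (2 * N - M)\<^sup>2 / 12) * W - (N * (N - M) * (2 * N - M) / 6 - (2 * N - M) ^ 3 / 216)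
    = (v + M / 2) * (v\<^sup>2 - 2 * (N - M) * v - M * (N - M)) / 2"
  unfolding assms by (simp add: field_simps) algebra


lemma weierstrass_normalization:
  fixes Y W :: "complex \<Rightarrow> complex"
  assumes "(Y has_field_derivative D) (at 0)" "Y 0 = 0" "((\<lambda>z. z\<^sup>2 * W z) \<longlongrightarrow> B) (at 0)" "D\<^sup>2 * B = 1"
  shows "((\<lambda>z. (Y z)\<^sup>2 * W z) \<longlongrightarrow> 1) (at 0)"
proof -
  have "((\<lambda>z. Y z / z) \<longlongrightarrow> D) (at 0)"
    using assms(1,2) by (simp add: has_field_derivative_iff)
  then have "((\<lambda>z. (Y z / z)\<^sup>2 * (z\<^sup>2 * W z)) \<longlongrightarrow> D\<^sup>2 * B) (at 0)"
    by (intro tendsto_intros assms)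
  moreover have ev: "\<forall>\<^sub>F z in at 0. (Y z / z)\<^sup>2 * (z\<^sup>2 * W z) = (Y z)\<^sup>2 * W z"
    using eventually_neq_at_within[of 0 0 UNIV] by eventually_elim (simp add: power_divide)
  ultimately show ?thesis unfolding assms(4) tendsto_cong[OF ev] by simp
qed

lemma is_pole_const_plus_divide:
  fixes f g :: "complex \<Rightarrow> complex"
  assumes "isCont f z" "f z \<noteq> 0" "g analytic_on {z}" "g z = 0" "deriv g z \<noteq> 0"
  shows "is_pole (\<lambda>w. c + f w / (g w)\<^sup>2) z"
proof -
  have "\<forall>\<^sub>F w in at z. g w \<noteq> 0"
    using DERIV_nonzero_imp_eventually_ne[OF analytic_derivI[OF assms(3)] assms(5)] assms(4) by simp
  moreover have "((\<lambda>w. (g w)\<^sup>2) \<longlongrightarrow> (g z)\<^sup>2) (at z)"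
    by (intro tendsto_intros isContD analytic_at_imp_isCont assms)
  ultimately have "filterlim (\<lambda>w. (g w)\<^sup>2) (at 0) (at z)"
    using assms(4) by (auto simp: filterlim_at)
  from is_pole_divide[OF assms(1) this assms(2)] show ?thesis
    using is_pole_plus_const_iff[of "\<lambda>w. f w / (g w)\<^sup>2" z c] by (simp add: add.commute)
qed

lemma elliptic_integral_mono:
  fixes n m h :: real and y :: "real \<Rightarrow> real"
  assumes nm: "0 < m" "m < n"
    and y: "\<And>t. (y has_real_derivative 1 / sqrt (n\<^sup>2 - m\<^sup>2 * (cos (t + h))\<^sup>2)) (at t)"
  shows "strict_mono y" "continuous_on UNIV y"
proof -
  have "n\<^sup>2 - m\<^sup>2 * (cos t)\<^sup>2 > 0" for t
  proof -
    have "m\<^sup>2 * (cos t)\<^sup>2 \<le> m\<^sup>2 * 1" by (intro mult_left_mono) (auto simp: abs_square_le_1)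
    also have "\<dots> < n\<^sup>2" using nm by (simp add: power_strict_mono)
    finally show ?thesis by simp
  qed
  then show "strict_mono y"
    by (intro strict_monoI DERIV_pos_imp_increasing[where f = y]) (use y in force)+
  show "continuous_on UNIV y"
    using y by (intro DERIV_continuous_on[of _ y]) (auto intro: has_field_derivative_at_within)
qed

text \<open>A common frame for \<open>phi0\<close> and \<open>phi1\<close>, whose \<open>W\<close>
  is a constant plus a multiple of \<open>1 / sin\<^sup>2 (t / 2)\<close>. The multiple is forced:
  \<open>Y z\<close> behaves like \<open>z / sqrt \<beta>\<close> when \<open>\<beta>\<close> is the
  radicand at 0, and \<open>Y\<^sup>2 W\<close> must tend to 1. In the hypothesis \<open>ode\<close>
  the letter \<open>c\<close> stands for \<open>cos (z / 2)\<close> and is known only through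
  \<open>s\<^sup>2 + c\<^sup>2 = 1\<close>, so each instance reduces to algebra.\<close>

lemma wp_extend_half_sine:
  fixes n m h \<alpha> \<beta> :: real and y :: "real \<Rightarrow> real"
  assumes nm: "0 < m" "m < n"
    and y: "\<And>t. (y has_real_derivative 1 / sqrt (n\<^sup>2 - m\<^sup>2 * (cos (t + h))\<^sup>2)) (at t)" "y 0 = 0"
    and \<beta>: "\<beta> = n\<^sup>2 - m\<^sup>2 * (cos h)\<^sup>2"
    and ode: "\<And>s c z :: complex. s\<^sup>2 + c\<^sup>2 = 1 \<Longrightarrow> s = sin (z / 2) \<Longrightarrow> s \<noteq> 0 \<Longrightarrow>
      (of_real \<beta> * c / (4 * s ^ 3))\<^sup>2 * ((of_real n)\<^sup>2 - (of_real m)\<^sup>2 * (cos (z + of_real h))\<^sup>2)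
      = 4 * (of_real \<alpha> + of_real \<beta> / 4 / s\<^sup>2) ^ 3 - of_real g2 * (of_real \<alpha> + of_real \<beta> / 4 / s\<^sup>2) - of_real g3"
    and regular: "\<And>t. sin (t / 2) \<noteq> 0 \<Longrightarrow> F (\<alpha> + \<beta> / 4 / (sin (t / 2))\<^sup>2) = \<phi> t"
    and singular: "\<And>t. sin (t / 2) = 0 \<Longrightarrow> (F \<longlongrightarrow> \<phi> t) at_infinity"
  shows "wp_extend F g2 g3 (y t) = \<phi> t"
proof -
  define \<Delta> where "\<Delta> = (\<lambda>z. (of_real n)\<^sup>2 - (of_real m)\<^sup>2 * (cos (z + of_real h))\<^sup>2 :: complex)"
  obtain S Y where S: "open S" "connected S" "\<And>t. complex_of_real t \<in> S"
    and pos: "\<And>z. z \<in> S \<Longrightarrow> Re (\<Delta> z) > 0"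
    and Y: "\<And>z. z \<in> S \<Longrightarrow> (Y has_field_derivative 1 / csqrt (\<Delta> z)) (at z)"
    and Yy: "\<And>t. Y (of_real t) = of_real (y t)"
    using elliptic_integral_extension[OF nm y(1) y(2)] unfolding \<Delta>_def by blast
  have dY: "deriv Y z = 1 / csqrt (\<Delta> z)" if "z \<in> S" for z
    using Y[OF that] by (rule DERIV_imp_deriv)
  have nz: "\<Delta> z \<noteq> 0" if "z \<in> S" for z using pos[OF that] by auto
  have S0: "0 \<in> S" using S(3)[of 0] by simp
  have \<beta>pos: "\<beta> > 0" and \<Delta>0: "\<Delta> 0 = of_real \<beta>"
    using pos[OF S0] by (simp_all add: \<Delta>_def \<beta> cos_of_real flip: of_real_power)
  define W where "W = (\<lambda>z::complex. of_real \<alpha> + of_real \<beta> / 4 / (sin (z / 2))\<^sup>2)"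
  have W_mero: "W meromorphic_on S"
    unfolding W_def by (intro meromorphic_intros analytic_on_imp_meromorphic_on analytic_intros) auto
  have Y0: "Y 0 = 0" using Yy[of 0] y(2) by simp
  have sin_lim: "((\<lambda>z::complex. sin (z / 2) / z) \<longlongrightarrow> 1 / 2) (at 0)"
  proof -
    have "((\<lambda>z::complex. sin (z / 2)) has_field_derivative 1 / 2) (at 0)"
      by (auto intro!: derivative_eq_intros)
    then show ?thesis by (simp add: has_field_derivative_iff)
  qed
  have "((\<lambda>z. z\<^sup>2 * of_real \<alpha> + of_real \<beta> / 4 / (sin (z / 2) / z)\<^sup>2) \<longlongrightarrow>
      0\<^sup>2 * of_real \<alpha> + of_real \<beta> / 4 / (1 / 2)\<^sup>2) (at (0::complex))"
    by (intro tendsto_intros sin_lim) auto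
  then have "((\<lambda>z. z\<^sup>2 * of_real \<alpha> + of_real \<beta> / 4 / (sin (z / 2) / z)\<^sup>2) \<longlongrightarrow> of_real \<beta>) (at (0::complex))"
    by (simp add: power2_eq_square)
  moreover have "z\<^sup>2 * of_real \<alpha> + of_real \<beta> / 4 / (sin (z / 2) / z)\<^sup>2 = z\<^sup>2 * W z" for z
    by (simp add: W_def power_divide distrib_left)
  ultimately have W_lim: "((\<lambda>z. z\<^sup>2 * W z) \<longlongrightarrow> of_real \<beta>) (at 0)" by simp
  have norm: "((\<lambda>z. (Y z)\<^sup>2 * W z) \<longlongrightarrow> 1) (at 0)"
    by (rule weierstrass_normalization[OF Y[OF S0] Y0 W_lim])
      (use \<beta>pos in \<open>simp add: \<Delta>0 power_one_over del: csqrt_of_real_nonneg\<close>)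
  have sin_ne: "\<forall>\<^sub>F z in at 0. sin (z / 2) \<noteq> (0::complex)"
    using tendsto_imp_eventually_ne[OF sin_lim, of 0] by (auto elim: eventually_mono)
  have "\<forall>\<^sub>F z in at 0. z \<in> S" using eventually_at_in_open'[OF S(1) S0] .
  then have W_ode: "\<forall>\<^sub>F z in at 0. (deriv W z)\<^sup>2 =
      (deriv Y z)\<^sup>2 * (4 * W z ^ 3 - of_real g2 * W z - of_real g3)"
    using sin_ne
  proof eventually_elim
    case (elim z)
    have "(W has_field_derivative - (of_real \<beta> * cos (z / 2) / (4 * sin (z / 2) ^ 3))) (at z)"
      unfolding W_def using elim(2)
      by (auto intro!: derivative_eq_intros simp: field_simps eval_nat_numeral)
    then have "(deriv W z)\<^sup>2 = (of_real \<beta> * cos (z / 2) / (4 * sin (z / 2) ^ 3))\<^sup>2"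
      by (simp add: DERIV_imp_deriv)
    moreover have "(of_real \<beta> * cos (z / 2) / (4 * sin (z / 2) ^ 3))\<^sup>2 * \<Delta> z
        = 4 * W z ^ 3 - of_real g2 * W z - of_real g3"
      unfolding \<Delta>_def W_def by (rule ode) (use elim in auto)
    moreover have "(deriv Y z)\<^sup>2 * \<Delta> z = 1"
      using nz[OF elim(1)] by (simp add: dY[OF elim(1)] power_divide)
    ultimately show ?case by (metis mult.assoc mult.commute mult.left_neutral)
  qed
  show ?thesis
  proof (rule wp_extend_param[where S = S and Y = Y and W = W and D = "\<lambda>t. sin (t / 2) = 0"
      and y = y and \<phi> = \<phi> and t = t and w = "\<lambda>t. \<alpha> + \<beta> / 4 / (sin (t / 2))\<^sup>2"])
    show "Y holomorphic_on S" using Y S(1) by (auto simp: holomorphic_on_open)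
    show "deriv Y z \<noteq> 0" if "z \<in> S" for z using nz[OF that] by (simp add: dY[OF that])
    have sr: "sin (complex_of_real t / 2) = of_real (sin (t / 2))" for t
      by (simp flip: sin_of_real)
    show "W analytic_on {of_real t}" if "sin (t / 2) \<noteq> 0" for t
      unfolding W_def by (intro analytic_intros) (use that in \<open>auto simp: sr\<close>)
    show "W (of_real t) = of_real (\<alpha> + \<beta> / 4 / (sin (t / 2))\<^sup>2)" for t
      by (simp add: W_def sr)
    show "is_pole W (of_real t)" if "sin (t / 2) = 0" for t
      unfolding W_def
    proof (rule is_pole_const_plus_divide)
      have "((\<lambda>z::complex. sin (z / 2)) has_field_derivative of_real (cos (t / 2)) / 2) (at (of_real t))"
        by (auto intro!: derivative_eq_intros simp flip: cos_of_real)
      then have "deriv (\<lambda>z::complex. sin (z / 2)) (of_real t) = of_real (cos (t / 2)) / 2"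
        by (rule DERIV_imp_deriv)
      then show "deriv (\<lambda>z::complex. sin (z / 2)) (of_real t) \<noteq> 0"
        using sin_zero_abs_cos_one[OF that] by auto
    qed (use \<beta>pos that in \<open>auto simp: sr intro!: analytic_intros\<close>)
  qed (use S Y0 Yy W_mero norm W_ode regular singular elliptic_integral_mono[OF nm y(1)] in auto)
qed

section \<open>The three functions in terms of the amplitude\<close>

lemma tendsto_divide_affine_at_infinity:
  fixes b d :: real
  shows "((\<lambda>w. d / (2 * w + b)) \<longlongrightarrow> 0) at_infinity"
proof -
  have "filterlim (\<lambda>w::real. 2 * w) at_infinity at_infinity"
    by (rule tendsto_mult_filterlim_at_infinity[OF tendsto_const _ filterlim_ident]) simp
  then have "filterlim (\<lambda>w. 2 * w + b) at_infinity at_infinity"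
    using tendsto_add_filterlim_at_infinity[OF tendsto_const[of b]] by (simp add: add.commute)
  then show ?thesis by (rule tendsto_divide_0[OF tendsto_const])
qed

text \<open>Solving \<open>1 - (n\<^sup>2 - m\<^sup>2) / (2 \<wp> + b1) = cos t\<close> gives
  \<open>2 \<wp> + b1 = (n\<^sup>2 - m\<^sup>2) / (1 - cos t)\<close>, that is
  \<open>(n\<^sup>2 - m\<^sup>2) / (2 sin\<^sup>2 (t / 2))\<close>. Hence
  \<open>\<alpha> = - b1 / 2\<close>, and \<open>\<beta> = n\<^sup>2 - m\<^sup>2\<close> is indeed
  the radicand at \<open>t = 0\<close>.\<close>

lemma phi0_eq:
  fixes n m :: real
  assumes nm: "0 < m" "m < n"
    and y: "\<And>t. (y has_real_derivative 1 / sqrt (n\<^sup>2 - m\<^sup>2 * (cos t)\<^sup>2)) (at t)" "y 0 = 0"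
  shows "phi0 n m (y t) = sqrt ((n\<^sup>2 + m\<^sup>2) / (2 * n\<^sup>2)) * cos t"
  unfolding phi0_def Let_def
proof (rule wp_extend_half_sine[OF nm, where y = y and h = 0 and \<alpha> = "- ((n\<^sup>2 - 5 * m\<^sup>2) / 6 / 2)"
      and \<beta> = "n\<^sup>2 - m\<^sup>2" and \<phi> = "\<lambda>t. sqrt ((n\<^sup>2 + m\<^sup>2) / (2 * n\<^sup>2)) * cos t" and t = t])
  have cos_half: "cos u = 1 - 2 * (sin (u / 2))\<^sup>2" for u :: real
    using cos_double_sin[of "u / 2"] by simp
  have nm2: "n\<^sup>2 - m\<^sup>2 > 0" using nm by (simp add: power_strict_mono)
  show "(y has_real_derivative 1 / sqrt (n\<^sup>2 - m\<^sup>2 * (cos (u + 0))\<^sup>2)) (at u)" for u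
    using y(1) by simp
  show "sqrt ((n\<^sup>2 + m\<^sup>2) / (2 * n\<^sup>2)) * (1 - (n\<^sup>2 - m\<^sup>2) /
      (2 * (- ((n\<^sup>2 - 5 * m\<^sup>2) / 6 / 2) + (n\<^sup>2 - m\<^sup>2) / 4 / (sin (u / 2))\<^sup>2) + (n\<^sup>2 - 5 * m\<^sup>2) / 6))
      = sqrt ((n\<^sup>2 + m\<^sup>2) / (2 * n\<^sup>2)) * cos u" if "sin (u / 2) \<noteq> 0" for u
  proof -
    have "2 * (- ((n\<^sup>2 - 5 * m\<^sup>2) / 6 / 2) + (n\<^sup>2 - m\<^sup>2) / 4 / (sin (u / 2))\<^sup>2) + (n\<^sup>2 - 5 * m\<^sup>2) / 6
        = (n\<^sup>2 - m\<^sup>2) / (2 * (sin (u / 2))\<^sup>2)"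
      using that by (simp add: field_simps)
    then show ?thesis using nm2 that unfolding cos_half by simp
  qed
  show "((\<lambda>w. sqrt ((n\<^sup>2 + m\<^sup>2) / (2 * n\<^sup>2)) * (1 - (n\<^sup>2 - m\<^sup>2) / (2 * w + (n\<^sup>2 - 5 * m\<^sup>2) / 6)))
      \<longlongrightarrow> sqrt ((n\<^sup>2 + m\<^sup>2) / (2 * n\<^sup>2)) * cos u) at_infinity" if "sin (u / 2) = 0" for u
  proof -
    have "((\<lambda>w. sqrt ((n\<^sup>2 + m\<^sup>2) / (2 * n\<^sup>2)) * (1 - (n\<^sup>2 - m\<^sup>2) / (2 * w + (n\<^sup>2 - 5 * m\<^sup>2) / 6)))
      \<longlongrightarrow> sqrt ((n\<^sup>2 + m\<^sup>2) / (2 * n\<^sup>2)) * (1 - 0)) at_infinity"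
      by (intro tendsto_mult tendsto_diff tendsto_const tendsto_divide_affine_at_infinity)
    then show ?thesis unfolding cos_half that by simp
  qed
  fix s c z :: complex
  assume sc: "s\<^sup>2 + c\<^sup>2 = 1" and s: "s = sin (z / 2)" "s \<noteq> 0"
  have c2: "c\<^sup>2 = 1 - s\<^sup>2" using sc by (simp add: algebra_simps)
  define N M where "N = (of_real n :: complex)\<^sup>2" and "M = (of_real m :: complex)\<^sup>2"
  define W v where "W = - ((N - 5 * M) / 6 / 2) + (N - M) / 4 / s\<^sup>2" and "v = (N - M) / (2 * s\<^sup>2)"
  have cosz: "cos z = 1 - 2 * s\<^sup>2"
    using cos_double_sin[of "z / 2"] by (simp add: s)
  have v: "v = 2 * W + (N - 5 * M) / 6"
    using s by (simp add: v_def W_def field_simps)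
  have "((N - M) * c / (4 * s ^ 3))\<^sup>2 * (N - M * (1 - 2 * s\<^sup>2)\<^sup>2)
      = (N - M)\<^sup>2 * c\<^sup>2 * (N - M * (1 - 2 * s\<^sup>2)\<^sup>2) / (16 * s ^ 6)"
    by (simp add: power_divide power_mult_distrib flip: power_mult)
  also have "\<dots> = (v - (N - M) / 2) * (v\<^sup>2 + 2 * M * v - M * (N - M)) / 2"
  proof -
    have "v - (N - M) / 2 = (N - M) * c\<^sup>2 / (2 * s\<^sup>2)"
      using s(2) unfolding v_def c2 by (simp add: field_simps eval_nat_numeral)
    moreover have "v\<^sup>2 + 2 * M * v - M * (N - M) = (N - M) * (N - M * (1 - 2 * s\<^sup>2)\<^sup>2) / (4 * s ^ 4)"
      using s(2) unfolding v_def by (simp add: field_simps eval_nat_numeral)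
    moreover have "D\<^sup>2 * C * e / (16 * s ^ 6) = (D * C / (2 * s\<^sup>2)) * (D * e / (4 * s ^ 4)) / 2" for D C e :: complex
      by (simp add: eval_nat_numeral)
    ultimately show ?thesis by (simp only:)
  qed
  also have "\<dots> = 4 * W ^ 3 - (N * M + (M + N)\<^sup>2 / 12) * W - (- (N * M * (M + N) / 6) + (M + N) ^ 3 / 216)"
    using weierstrass_cubic_phi0[OF v] by simp
  finally show "(of_real (n\<^sup>2 - m\<^sup>2) * c / (4 * s ^ 3))\<^sup>2 *
        ((of_real n)\<^sup>2 - (of_real m)\<^sup>2 * (cos (z + of_real 0))\<^sup>2)
      = 4 * (of_real (- ((n\<^sup>2 - 5 * m\<^sup>2) / 6 / 2)) + of_real (n\<^sup>2 - m\<^sup>2) / 4 / s\<^sup>2) ^ 3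
        - of_real (n\<^sup>2 * m\<^sup>2 + (m\<^sup>2 + n\<^sup>2)\<^sup>2 / 12)
          * (of_real (- ((n\<^sup>2 - 5 * m\<^sup>2) / 6 / 2)) + of_real (n\<^sup>2 - m\<^sup>2) / 4 / s\<^sup>2)
        - of_real (- (n\<^sup>2 * m\<^sup>2 * (m\<^sup>2 + n\<^sup>2) / 6) + (m\<^sup>2 + n\<^sup>2) ^ 3 / 216)"
    by (simp add: W_def N_def M_def cosz)
qed (use y in auto)

text \<open>Solving \<open>- 1 + n\<^sup>2 / (2 \<wp> + b2) = - cos t\<close> leads to the same
  half-angle form, now with \<open>\<beta> = n\<^sup>2\<close>. The choice
  \<open>h = - (pi / 2)\<close> replaces the cosine in the radicand by a sine, whose value at 0 fits
  this \<open>\<beta>\<close>; the shift of the argument in \<open>phi1\<close> is absorbed into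
  \<open>y t\<close>.\<close>

lemma phi1_eq:
  fixes n m :: real
  assumes nm: "0 < m" "m < n"
    and y: "\<And>t. (y has_real_derivative 1 / sqrt (n\<^sup>2 - m\<^sup>2 * (sin t)\<^sup>2)) (at t)" "y 0 = 0"
    and x: "x + 1 / n * ellK (m / n) = y t"
  shows "phi1 n m x = - (cos t / sqrt 2)"
  unfolding phi1_def Let_def x
proof (rule wp_extend_half_sine[OF nm, where y = y and h = "- (pi / 2)" and \<alpha> = "- ((4 * m\<^sup>2 + n\<^sup>2) / 6 / 2)"
      and \<beta> = "n\<^sup>2" and \<phi> = "\<lambda>t. - (cos t / sqrt 2)" and t = t])
  have cos_half: "cos u = 1 - 2 * (sin (u / 2))\<^sup>2" for u :: real
    using cos_double_sin[of "u / 2"] by simp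
  have n: "n > 0" using nm by simp
  have cos_shift: "cos (u + - (pi / 2)) = sin u" for u :: real by (simp add: cos_diff)
  show "(y has_real_derivative 1 / sqrt (n\<^sup>2 - m\<^sup>2 * (cos (u + - (pi / 2)))\<^sup>2)) (at u)" for u
    using y(1) unfolding cos_shift .
  show "1 / sqrt 2 * (- 1 + n\<^sup>2 /
      (2 * (- ((4 * m\<^sup>2 + n\<^sup>2) / 6 / 2) + n\<^sup>2 / 4 / (sin (u / 2))\<^sup>2) + (4 * m\<^sup>2 + n\<^sup>2) / 6))
      = - (cos u / sqrt 2)" if "sin (u / 2) \<noteq> 0" for u
  proof -
    have "2 * (- ((4 * m\<^sup>2 + n\<^sup>2) / 6 / 2) + n\<^sup>2 / 4 / (sin (u / 2))\<^sup>2) + (4 * m\<^sup>2 + n\<^sup>2) / 6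
        = n\<^sup>2 / (2 * (sin (u / 2))\<^sup>2)"
      using that by (simp add: field_simps)
    then show ?thesis using n that unfolding cos_half by (simp add: field_simps)
  qed
  show "((\<lambda>w. 1 / sqrt 2 * (- 1 + n\<^sup>2 / (2 * w + (4 * m\<^sup>2 + n\<^sup>2) / 6))) \<longlongrightarrow> - (cos u / sqrt 2)) at_infinity"
    if "sin (u / 2) = 0" for u
  proof -
    have "((\<lambda>w. 1 / sqrt 2 * (- 1 + n\<^sup>2 / (2 * w + (4 * m\<^sup>2 + n\<^sup>2) / 6))) \<longlongrightarrow> 1 / sqrt 2 * (- 1 + 0)) at_infinity"
      by (intro tendsto_mult tendsto_add tendsto_const tendsto_divide_affine_at_infinity)
    then show ?thesis unfolding cos_half that by simp
  qed
  fix s c z :: complex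
  assume sc: "s\<^sup>2 + c\<^sup>2 = 1" and s: "s = sin (z / 2)" "s \<noteq> 0"
  have c2: "c\<^sup>2 = 1 - s\<^sup>2" using sc by (simp add: algebra_simps)
  define N M where "N = (of_real n :: complex)\<^sup>2" and "M = (of_real m :: complex)\<^sup>2"
  define W v where "W = - ((4 * M + N) / 6 / 2) + N / 4 / s\<^sup>2" and "v = N / (2 * s\<^sup>2)"
  have "cos (z + of_real (- (pi / 2))) = sin z"
    by (simp add: cos_diff flip: cos_of_real sin_of_real)
  moreover have "(sin z)\<^sup>2 = 4 * s\<^sup>2 * c\<^sup>2"
  proof -
    have "sin z = 2 * s * cos (z / 2)" using sin_double[of "z / 2"] by (simp add: s)
    \<comment> \<open>\<open>c\<close> is \<open>cos (z / 2)\<close> only up to sign, and the square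
      removes the ambiguity.\<close>
    moreover have "(cos (z / 2))\<^sup>2 = c\<^sup>2" using sc sin_cos_squared_add[of "z / 2"] unfolding s by (metis add_left_cancel)
    ultimately show ?thesis by (simp add: power_mult_distrib)
  qed
  ultimately have cosz: "(cos (z + of_real (- (pi / 2))))\<^sup>2 = 4 * s\<^sup>2 * c\<^sup>2" by simp
  have v: "v = 2 * W + (4 * M + N) / 6"
    using s by (simp add: v_def W_def field_simps)
  have "(N * c / (4 * s ^ 3))\<^sup>2 * (N - M * (4 * s\<^sup>2 * c\<^sup>2)) = N\<^sup>2 * c\<^sup>2 * (N - M * (4 * s\<^sup>2 * c\<^sup>2)) / (16 * s ^ 6)"
    by (simp add: power_divide power_mult_distrib flip: power_mult)
  also have "\<dots> = (v - N / 2) * (v\<^sup>2 - 2 * M * v + M * N) / 2"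
  proof -
    have "v - N / 2 = N * c\<^sup>2 / (2 * s\<^sup>2)"
      using s(2) unfolding v_def c2 by (simp add: field_simps eval_nat_numeral)
    moreover have "v\<^sup>2 - 2 * M * v + M * N = N * (N - M * (4 * s\<^sup>2 * c\<^sup>2)) / (4 * s ^ 4)"
      using s(2) unfolding v_def c2 by (simp add: field_simps eval_nat_numeral)
    moreover have "D\<^sup>2 * C * e / (16 * s ^ 6) = (D * C / (2 * s\<^sup>2)) * (D * e / (4 * s ^ 4)) / 2" for D C e :: complex
      by (simp add: eval_nat_numeral)
    ultimately show ?thesis by (simp only:)
  qed
  also have "\<dots> = 4 * W ^ 3 - (M * (M - N) + (2 * M - N)\<^sup>2 / 12) * W - (M * (M - N) * (2 * M - N) / 6 - (2 * M - N) ^ 3 / 216)"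
    using weierstrass_cubic_phi1[OF v] by simp
  finally show "(of_real (n\<^sup>2) * c / (4 * s ^ 3))\<^sup>2 *
        ((of_real n)\<^sup>2 - (of_real m)\<^sup>2 * (cos (z + of_real (- (pi / 2))))\<^sup>2)
      = 4 * (of_real (- ((4 * m\<^sup>2 + n\<^sup>2) / 6 / 2)) + of_real (n\<^sup>2) / 4 / s\<^sup>2) ^ 3
        - of_real (m\<^sup>2 * (m\<^sup>2 - n\<^sup>2) + (2 * m\<^sup>2 - n\<^sup>2)\<^sup>2 / 12)
          * (of_real (- ((4 * m\<^sup>2 + n\<^sup>2) / 6 / 2)) + of_real (n\<^sup>2) / 4 / s\<^sup>2)
        - of_real (m\<^sup>2 * (m\<^sup>2 - n\<^sup>2) * (2 * m\<^sup>2 - n\<^sup>2) / 6 - (2 * m\<^sup>2 - n\<^sup>2) ^ 3 / 216)"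
    unfolding cosz by (simp add: W_def N_def M_def)
qed (use y in auto)

text \<open>Solving \<open>s (1 + m\<^sup>2 / v) = e\<close> for \<open>v = 2 \<wp> + b3\<close>
  gives \<open>v = m\<^sup>2 s / (e - s)\<close>, and
  \<open>e\<^sup>2 - s\<^sup>2 = m\<^sup>2 sin\<^sup>2 t\<close> turns this into
  \<open>s (e + s) / sin\<^sup>2 t\<close>. The radical \<open>e\<close> survives in
  \<open>W\<close>, so the half-angle frame does not fit; the poles now lie at all multiples of
  pi.\<close>

lemma phi2_eq:
  fixes n m :: real
  assumes nm: "0 < m" "m < n"
    and y: "\<And>t. (y has_real_derivative 1 / sqrt (n\<^sup>2 - m\<^sup>2 * (cos t)\<^sup>2)) (at t)" "y 0 = 0"
  shows "phi2 n m (y t) = sqrt (n\<^sup>2 - m\<^sup>2 * (cos t)\<^sup>2) / (sqrt 2 * n)"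
proof -
  define b3 where "b3 = (4 * n\<^sup>2 - 5 * m\<^sup>2) / 6"
  define s where "s = sqrt (n\<^sup>2 - m\<^sup>2)"
  define e where "e = (\<lambda>u. sqrt (n\<^sup>2 - m\<^sup>2 * (cos u)\<^sup>2))"
  have nm2: "n\<^sup>2 - m\<^sup>2 > 0" using nm by (simp add: power_strict_mono)
  then have s: "s > 0" "s\<^sup>2 = n\<^sup>2 - m\<^sup>2" by (simp_all add: s_def)
  have C: "sqrt ((n\<^sup>2 - m\<^sup>2) / (2 * n\<^sup>2)) = s / (sqrt 2 * n)"
    using nm by (simp add: s_def real_sqrt_divide real_sqrt_mult)
  define \<Delta> where "\<Delta> = (\<lambda>z. (of_real n)\<^sup>2 - (of_real m)\<^sup>2 * (cos z)\<^sup>2 :: complex)"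
  obtain S Y where S: "open S" "connected S" "\<And>t. complex_of_real t \<in> S"
    and pos: "\<And>z. z \<in> S \<Longrightarrow> Re (\<Delta> z) > 0"
    and Y: "\<And>z. z \<in> S \<Longrightarrow> (Y has_field_derivative 1 / csqrt (\<Delta> z)) (at z)"
    and Yy: "\<And>t. Y (of_real t) = of_real (y t)"
    using elliptic_integral_extension[OF nm, of y 0] y unfolding \<Delta>_def by auto
  define E where "E = (\<lambda>z. csqrt (\<Delta> z))"
  have dY: "deriv Y z = 1 / E z" if "z \<in> S" for z
    unfolding E_def using Y[OF that] by (rule DERIV_imp_deriv)
  have E2: "(E z)\<^sup>2 = \<Delta> z" for z by (simp add: E_def)
  have nz: "\<Delta> z \<notin> \<real>\<^sub>\<le>\<^sub>0" "E z \<noteq> 0" if "z \<in> S" for z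
    using pos[OF that] by (auto simp: E_def complex_nonpos_Reals_iff)
  have E_an: "E analytic_on {z}" if "z \<in> S" for z
    unfolding E_def using nz(1)[OF that] unfolding \<Delta>_def by (intro analytic_intros) auto
  have E_real: "E (of_real u) = of_real (e u)" and e: "e u > 0" "(e u)\<^sup>2 = n\<^sup>2 - m\<^sup>2 * (cos u)\<^sup>2" for u
  proof -
    have \<Delta>u: "\<Delta> (of_real u) = of_real (n\<^sup>2 - m\<^sup>2 * (cos u)\<^sup>2)" by (simp add: \<Delta>_def cos_of_real)
    have "n\<^sup>2 - m\<^sup>2 * (cos u)\<^sup>2 > 0" using pos[OF S(3)[of u]] unfolding \<Delta>u by simp
    then show "E (of_real u) = of_real (e u)" "e u > 0" "(e u)\<^sup>2 = n\<^sup>2 - m\<^sup>2 * (cos u)\<^sup>2"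
      unfolding E_def e_def \<Delta>u by (simp_all only: csqrt_of_real less_imp_le) auto
  qed
  have e_sq: "m\<^sup>2 * (sin u)\<^sup>2 = (e u - s) * (e u + s)" for u
  proof -
    have "(e u - s) * (e u + s) = (e u)\<^sup>2 - s\<^sup>2" by (simp add: power2_eq_square algebra_simps)
    then show ?thesis by (simp add: e(2) s(2) sin_squared_eq algebra_simps)
  qed
  have E_sq: "(of_real m)\<^sup>2 * (sin z)\<^sup>2 = (E z - of_real s) * (E z + of_real s)" for z
  proof -
    have "(E z - of_real s) * (E z + of_real s) = (E z)\<^sup>2 - (of_real s)\<^sup>2"
      by (simp add: power2_eq_square algebra_simps)
    also have "(of_real s :: complex)\<^sup>2 = (of_real n)\<^sup>2 - (of_real m)\<^sup>2"
      by (simp add: s(2) flip: of_real_power of_real_diff)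
    finally show ?thesis by (simp add: E2 \<Delta>_def sin_squared_eq algebra_simps)
  qed
  define f where "f = (\<lambda>z. of_real s * (E z + of_real s) / 2)"
  define W where "W = (\<lambda>z. of_real (- (b3 / 2)) + f z / (sin z)\<^sup>2)"
  have f_an: "f analytic_on {z}" if "z \<in> S" for z
    unfolding f_def by (intro analytic_intros E_an that) auto
  have S0: "0 \<in> S" using S(3)[of 0] by simp
  have E0: "E 0 = of_real s" using E_real[of 0] by (simp add: e_def s_def)
  have sin_lim: "((\<lambda>z::complex. sin z / z) \<longlongrightarrow> 1) (at 0)"
  proof -
    have "(sin has_field_derivative cos (0::complex)) (at 0)" by (rule DERIV_sin)
    then show ?thesis by (simp add: has_field_derivative_iff)
  qed
  have W_lim: "((\<lambda>z. z\<^sup>2 * W z) \<longlongrightarrow> (of_real s)\<^sup>2) (at 0)"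
  proof -
    have "((\<lambda>z. z\<^sup>2 * of_real (- (b3 / 2)) + f z / (sin z / z)\<^sup>2) \<longlongrightarrow>
        0\<^sup>2 * of_real (- (b3 / 2)) + f 0 / 1\<^sup>2) (at (0::complex))"
      by (intro tendsto_intros sin_lim isContD analytic_at_imp_isCont f_an S0) auto
    moreover have "z\<^sup>2 * of_real (- (b3 / 2)) + f z / (sin z / z)\<^sup>2 = z\<^sup>2 * W z" for z
      by (simp add: W_def power_divide algebra_simps)
    moreover have "f 0 = (of_real s)\<^sup>2" by (simp add: f_def E0 power2_eq_square)
    ultimately show ?thesis by simp
  qed
  have Y0: "Y 0 = 0" using Yy[of 0] y(2) by simp
  have norm: "((\<lambda>z. (Y z)\<^sup>2 * W z) \<longlongrightarrow> 1) (at 0)"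
    by (rule weierstrass_normalization[OF Y[OF S0, folded E_def] Y0 W_lim])
      (use s E2[of 0] in \<open>simp add: E0 power_divide del: csqrt_of_real_nonneg\<close>, use nz(1)[OF S0] in auto)
  have sin_ne: "\<forall>\<^sub>F z in at 0. sin z \<noteq> (0::complex)"
    using tendsto_imp_eventually_ne[OF sin_lim, of 0] by (auto elim: eventually_mono)
  have "\<forall>\<^sub>F z in at 0. z \<in> S" using eventually_at_in_open'[OF S(1) S0] .
  then have W_ode: "\<forall>\<^sub>F z in at 0. (deriv W z)\<^sup>2 =
      (deriv Y z)\<^sup>2 * (4 * W z ^ 3 - of_real (n\<^sup>2 * (n\<^sup>2 - m\<^sup>2) + (2 * n\<^sup>2 - m\<^sup>2)\<^sup>2 / 12) * W z
        - of_real (n\<^sup>2 * (n\<^sup>2 - m\<^sup>2) * (2 * n\<^sup>2 - m\<^sup>2) / 6 - (2 * n\<^sup>2 - m\<^sup>2) ^ 3 / 216))"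
    using sin_ne
  proof eventually_elim
    case (elim z)
    define x c \<epsilon> \<rho> where "x = sin z" and "c = cos z" and "\<epsilon> = E z" and "\<rho> = (of_real s :: complex)"
    define N M where "N = (of_real n :: complex)\<^sup>2" and "M = (of_real m :: complex)\<^sup>2"
    have x0: "x \<noteq> 0" and \<epsilon>0: "\<epsilon> \<noteq> 0" using elim nz(2) by (auto simp: x_def \<epsilon>_def)
    have c2: "c\<^sup>2 = 1 - x\<^sup>2" by (simp add: c_def x_def cos_squared_eq)
    have Mx: "M * x\<^sup>2 = (\<epsilon> - \<rho>) * (\<epsilon> + \<rho>)" unfolding M_def x_def \<epsilon>_def \<rho>_def by (rule E_sq)
    have NM: "N - M = \<rho>\<^sup>2" by (simp add: N_def M_def \<rho>_def s(2) flip: of_real_power of_real_diff)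
    have "(E has_field_derivative M * c * x / \<epsilon>) (at z)"
      unfolding E_def using nz[OF elim(1)] unfolding \<Delta>_def
      by (auto intro!: derivative_eq_intros simp: M_def c_def x_def \<epsilon>_def E_def \<Delta>_def field_simps)
    then have df: "(f has_field_derivative \<rho> * (M * c * x / \<epsilon>) / 2) (at z)"
      unfolding f_def \<rho>_def by (auto intro!: derivative_eq_intros simp: mult_ac)
    have dx: "((\<lambda>z. (sin z)\<^sup>2) has_field_derivative 2 * x * c) (at z)"
      by (auto intro!: derivative_eq_intros simp: x_def c_def)
    have fz: "f z = \<rho> * (\<epsilon> + \<rho>) / 2" by (simp add: f_def \<rho>_def \<epsilon>_def)
    have "(W has_field_derivative
        0 + (\<rho> * (M * c * x / \<epsilon>) / 2 * x\<^sup>2 - f z * (2 * x * c)) / (x\<^sup>2 * x\<^sup>2)) (at z)"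
      unfolding W_def x_def
      by (rule DERIV_add DERIV_const DERIV_divide df[unfolded x_def] dx[unfolded x_def])+
        (use elim(2) in simp)
    then have "deriv W z = (\<rho> * (M * c * x / \<epsilon>) / 2 * x\<^sup>2 - (\<rho> * (\<epsilon> + \<rho>) / 2) * (2 * x * c)) / (x\<^sup>2 * x\<^sup>2)"
      unfolding fz by (simp add: DERIV_imp_deriv)
    also have "\<dots> = \<rho> * c * (M * x\<^sup>2 - 2 * \<epsilon> * (\<epsilon> + \<rho>)) / (2 * \<epsilon> * x ^ 3)"
      using x0 \<epsilon>0 by (simp add: field_simps eval_nat_numeral)
    \<comment> \<open>Factoring \<open>M x\<^sup>2\<close> collapses the numerator to a square. The
      squared derivative then carries the fourth power of \<open>\<epsilon> + \<rho>\<close>, to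
      which the linear and the quadratic factor of the cubic contribute a square each.\<close>
    also have "M * x\<^sup>2 - 2 * \<epsilon> * (\<epsilon> + \<rho>) = - ((\<epsilon> + \<rho>)\<^sup>2)"
      unfolding Mx by (simp add: power2_eq_square algebra_simps)
    finally have dW: "(deriv W z)\<^sup>2 = \<rho>\<^sup>2 * c\<^sup>2 * (\<epsilon> + \<rho>) ^ 4 / (4 * \<epsilon>\<^sup>2 * x ^ 6)"
      by (simp add: power_divide power_mult_distrib flip: power_mult)
    define v where "v = \<rho> * (\<epsilon> + \<rho>) / x\<^sup>2"
    have v: "v = 2 * W z + (4 * N - 5 * M) / 6"
      by (simp add: W_def f_def v_def b3_def N_def M_def x_def \<epsilon>_def \<rho>_def)
    have "v + M / 2 = (\<epsilon> + \<rho>)\<^sup>2 / (2 * x\<^sup>2)"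
    proof -
      have "v + M / 2 = (2 * \<rho> * (\<epsilon> + \<rho>) + M * x\<^sup>2) / (2 * x\<^sup>2)"
        using x0 by (simp add: v_def field_simps)
      also have "2 * \<rho> * (\<epsilon> + \<rho>) + M * x\<^sup>2 = (\<epsilon> + \<rho>)\<^sup>2"
        unfolding Mx by (simp add: power2_eq_square algebra_simps)
      finally show ?thesis .
    qed
    moreover have "v\<^sup>2 - 2 * (N - M) * v - M * (N - M) = \<rho>\<^sup>2 * (\<epsilon> + \<rho>)\<^sup>2 * c\<^sup>2 / x ^ 4"
    proof -
      have "v\<^sup>2 - 2 * (N - M) * v - M * (N - M)
          = \<rho>\<^sup>2 * ((\<epsilon> + \<rho>)\<^sup>2 - x\<^sup>2 * (2 * \<rho> * (\<epsilon> + \<rho>) + M * x\<^sup>2)) / x ^ 4"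
        using x0 unfolding NM v_def by (simp add: field_simps eval_nat_numeral)
      also have "2 * \<rho> * (\<epsilon> + \<rho>) + M * x\<^sup>2 = (\<epsilon> + \<rho>)\<^sup>2"
        unfolding Mx by (simp add: power2_eq_square algebra_simps)
      finally show ?thesis by (simp add: c2 algebra_simps)
    qed
    ultimately have K: "(v + M / 2) * (v\<^sup>2 - 2 * (N - M) * v - M * (N - M)) / 2
        = \<rho>\<^sup>2 * c\<^sup>2 * (\<epsilon> + \<rho>) ^ 4 / (4 * x ^ 6)"
      by (simp add: eval_nat_numeral)
    have "(deriv W z)\<^sup>2 = (deriv Y z)\<^sup>2 * ((v + M / 2) * (v\<^sup>2 - 2 * (N - M) * v - M * (N - M)) / 2)"
      unfolding dW dY[OF elim(1)] \<epsilon>_def[symmetric] K by (simp add: power_divide mult_ac)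
    then show ?case
      unfolding weierstrass_cubic_phi2[OF v, symmetric] by (simp add: N_def M_def)
  qed
  have et: "sqrt (n\<^sup>2 - m\<^sup>2 * (cos t)\<^sup>2) = e t" by (simp add: e_def)
  show ?thesis
    unfolding phi2_def Let_def b3_def[symmetric] C et
  proof (rule wp_extend_param[where S = S and Y = Y and W = W and D = "\<lambda>t. sin t = 0"
      and y = y and \<phi> = "\<lambda>t. e t / (sqrt 2 * n)" and t = t
      and w = "\<lambda>t. - (b3 / 2) + s * (e t + s) / 2 / (sin t)\<^sup>2"])
    show "Y holomorphic_on S" using Y S(1) by (auto simp: holomorphic_on_open)
    show "deriv Y z \<noteq> 0" if "z \<in> S" for z using nz[OF that] by (simp add: dY[OF that])
    show "W meromorphic_on S"
      unfolding W_def
      by (intro meromorphic_intros analytic_on_imp_meromorphic_on analytic_intros)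
        (use f_an analytic_on_analytic_at in blast)
    show "W analytic_on {of_real u}" if "sin u \<noteq> 0" for u
      unfolding W_def by (intro analytic_intros f_an S) (use that in \<open>auto simp: sin_of_real\<close>)
    show "W (of_real u) = of_real (- (b3 / 2) + s * (e u + s) / 2 / (sin u)\<^sup>2)" for u
      by (simp add: W_def f_def E_real sin_of_real)
    show "s / (sqrt 2 * n) * (1 + m\<^sup>2 / (2 * (- (b3 / 2) + s * (e u + s) / 2 / (sin u)\<^sup>2) + b3))
        = e u / (sqrt 2 * n)" if "sin u \<noteq> 0" for u
    proof -
      have es: "e u + s > 0" using e(1)[of u] s by simp
      have "2 * (- (b3 / 2) + s * (e u + s) / 2 / (sin u)\<^sup>2) + b3 = s * (e u + s) / (sin u)\<^sup>2"
        by simp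
      then have "1 + m\<^sup>2 / (2 * (- (b3 / 2) + s * (e u + s) / 2 / (sin u)\<^sup>2) + b3)
          = 1 + m\<^sup>2 * (sin u)\<^sup>2 / (s * (e u + s))"
        by simp
      also have "\<dots> = 1 + (e u - s) / s"
        unfolding e_sq using es by simp
      also have "\<dots> = e u / s"
        using s(1) by (simp add: diff_divide_distrib)
      finally show ?thesis using s by simp
    qed
    show "is_pole W (of_real u)" if "sin u = 0" for u
      unfolding W_def
    proof (rule is_pole_const_plus_divide)
      show "isCont f (of_real u)" by (intro analytic_at_imp_isCont f_an S)
      show "f (of_real u) \<noteq> 0"
        using e(1)[of u] s by (simp add: f_def E_real flip: of_real_add)
      have "deriv sin (complex_of_real u) = cos (of_real u)" by (intro DERIV_imp_deriv DERIV_sin)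
      then show "deriv sin (complex_of_real u) \<noteq> 0"
        using sin_zero_abs_cos_one[OF that] by (auto simp: cos_of_real)
    qed (use that in \<open>auto simp: sin_of_real intro!: analytic_intros\<close>)
    show "((\<lambda>w. s / (sqrt 2 * n) * (1 + m\<^sup>2 / (2 * w + b3))) \<longlongrightarrow> e u / (sqrt 2 * n)) at_infinity"
      if "sin u = 0" for u
    proof -
      have "((\<lambda>w. s / (sqrt 2 * n) * (1 + m\<^sup>2 / (2 * w + b3))) \<longlongrightarrow> s / (sqrt 2 * n) * (1 + 0)) at_infinity"
        by (intro tendsto_mult tendsto_add tendsto_const tendsto_divide_affine_at_infinity)
      moreover have "e u = s" using that by (simp add: e_def s_def cos_squared_eq)
      ultimately show ?thesis by simp
    qed
  qed (use S Y0 Yy norm W_ode elliptic_integral_mono[OF nm, of y 0] y in auto)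
qed

section \<open>Landen's transformation\<close>

lemma LBINT_has_real_derivative:
  fixes f :: "real \<Rightarrow> real"
  assumes "continuous_on UNIV f"
  shows "((\<lambda>u. LBINT t=0..u. f t) has_real_derivative f x) (at x)"
proof -
  \<comment> \<open>The interval has both 0 and \<open>x\<close> in its interior, so the derivative
    within it is the two-sided one, for either sign of \<open>x\<close>.\<close>
  define a b where "a = min 0 x - 1" and "b = max 0 x + 1"
  have "((\<lambda>u. LBINT t=ereal 0..u. f t) has_vector_derivative f x) (at x within {a..b})"
    by (rule interval_integral_FTC2)
      (auto simp: a_def b_def intro: continuous_on_subset[OF assms])
  moreover have "x \<in> interior {a..b}" by (auto simp: a_def b_def interior_atLeastAtMost_real)
  ultimately show ?thesis
    unfolding has_real_derivative_iff_has_vector_derivative zero_ereal_def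
    by (simp only: at_within_interior)
qed

lemma DERIV_eq_imp_eq:
  fixes f g :: "real \<Rightarrow> real"
  assumes "\<And>x. (f has_real_derivative d x) (at x)" "\<And>x. (g has_real_derivative d x) (at x)" "f a = g a"
  shows "f x = g x"
proof -
  have "((\<lambda>x. f x - g x) has_real_derivative 0) (at x)" for x
    using DERIV_diff[OF assms(1) assms(2)] by simp
  then have "f x - g x = f a - g a" by (intro DERIV_isconst_all) auto
  then show ?thesis using assms(3) by simp
qed

text \<open>For \<open>0 < m < n\<close> this is Legendre's incomplete integral of the first kind
  with amplitude \<open>\<theta>\<close> and modulus \<open>m / n\<close>, divided by
  \<open>n\<close>.\<close>

definition elliptic_F :: "real \<Rightarrow> real \<Rightarrow> real \<Rightarrow> real" where
  "elliptic_F n m \<theta> = (LBINT t=0..\<theta>. 1 / sqrt (n\<^sup>2 - m\<^sup>2 * (sin t)\<^sup>2))"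

context
  fixes n m :: real
  assumes nm: "0 < m" "m < n"
begin

lemma elliptic_radicand_pos: "n\<^sup>2 - m\<^sup>2 * (sin t)\<^sup>2 > 0"
proof -
  have "m\<^sup>2 * (sin t)\<^sup>2 \<le> m\<^sup>2 * 1" by (intro mult_left_mono) (auto simp: abs_square_le_1)
  also have "\<dots> < n\<^sup>2" using nm by (simp add: power_strict_mono)
  finally show ?thesis by simp
qed

lemma elliptic_F_deriv: "(elliptic_F n m has_real_derivative 1 / sqrt (n\<^sup>2 - m\<^sup>2 * (sin x)\<^sup>2)) (at x)"
proof -
  have "sqrt (n\<^sup>2 - m\<^sup>2 * (sin t)\<^sup>2) \<noteq> 0" for t
    using elliptic_radicand_pos[of t] by simp
  then show ?thesis
    unfolding elliptic_F_def
    by (intro LBINT_has_real_derivative continuous_intros ballI)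
qed

lemma elliptic_F_0 [simp]: "elliptic_F n m 0 = 0"
  by (simp add: elliptic_F_def zero_ereal_def)

lemma elliptic_F_shift_deriv:
  "((\<lambda>x. elliptic_F n m (x + a)) has_real_derivative 1 / sqrt (n\<^sup>2 - m\<^sup>2 * (sin (x + a))\<^sup>2)) (at x)"
  using elliptic_F_deriv[of "x + a"] unfolding DERIV_shift .

lemma elliptic_F_minus: "elliptic_F n m (- x) = - elliptic_F n m x"
proof -
  have "((\<lambda>x. - elliptic_F n m (- x)) has_real_derivative 1 / sqrt (n\<^sup>2 - m\<^sup>2 * (sin x)\<^sup>2)) (at x)" for x
    using DERIV_minus[OF DERIV_mirror[THEN iffD1, OF elliptic_F_deriv[of "- x"]]] by simp
  from DERIV_eq_imp_eq[OF this elliptic_F_deriv, of 0 x] show ?thesis by simp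
qed

lemma elliptic_F_plus_pi: "elliptic_F n m (x + pi) = elliptic_F n m x + 2 * elliptic_F n m (pi / 2)"
\<comment> \<open>The integrand has period pi. The two sides are matched at
  \<open>- (pi / 2)\<close>, where oddness makes both equal to
  \<open>elliptic_F n m (pi / 2)\<close>.\<close>
proof (rule DERIV_eq_imp_eq[of "\<lambda>x. elliptic_F n m (x + pi)" _ _ "- (pi / 2)"])
  show "((\<lambda>x. elliptic_F n m (x + pi)) has_real_derivative 1 / sqrt (n\<^sup>2 - m\<^sup>2 * (sin x)\<^sup>2)) (at x)" for x
    using elliptic_F_shift_deriv[of pi x] by simp
  show "((\<lambda>x. elliptic_F n m x + 2 * elliptic_F n m (pi / 2)) has_real_derivative 1 / sqrt (n\<^sup>2 - m\<^sup>2 * (sin x)\<^sup>2)) (at x)" for x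
    using elliptic_F_deriv by (auto intro!: derivative_eq_intros)
qed (simp add: elliptic_F_minus)

lemma ellK_eq_elliptic_F: "1 / n * ellK (m / n) = elliptic_F n m (pi / 2)"
proof -
  have eq: "1 / n * (1 / sqrt (1 - (m / n)\<^sup>2 * (sin t)\<^sup>2)) = 1 / sqrt (n\<^sup>2 - m\<^sup>2 * (sin t)\<^sup>2)" for t
  proof -
    have "n\<^sup>2 - m\<^sup>2 * (sin t)\<^sup>2 = n\<^sup>2 * (1 - (m / n)\<^sup>2 * (sin t)\<^sup>2)"
      using nm by (simp add: field_simps)
    then show ?thesis using nm by (simp add: real_sqrt_mult)
  qed
  have "1 - (m / n)\<^sup>2 * (sin t)\<^sup>2 > 0" for t
    using elliptic_radicand_pos[of t] nm by (simp add: field_simps)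
  then have ne: "sqrt (1 - (m / n)\<^sup>2 * (sin t)\<^sup>2) \<noteq> 0" for t
    by (metis real_sqrt_gt_zero less_irrefl)
  have "((\<lambda>u. LBINT t=0..u. 1 / sqrt (1 - (m / n)\<^sup>2 * (sin t)\<^sup>2)) has_real_derivative
      1 / sqrt (1 - (m / n)\<^sup>2 * (sin x)\<^sup>2)) (at x)" for x
    by (rule LBINT_has_real_derivative) (intro continuous_intros ballI ne)
  from DERIV_cmult[OF this, of "1 / n"]
  have "((\<lambda>u. 1 / n * (LBINT t=0..u. 1 / sqrt (1 - (m / n)\<^sup>2 * (sin t)\<^sup>2))) has_real_derivative
      1 / sqrt (n\<^sup>2 - m\<^sup>2 * (sin x)\<^sup>2)) (at x)" for x unfolding eq .
  from DERIV_eq_imp_eq[OF this elliptic_F_deriv, of 0 "pi / 2"] show ?thesis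
    by (simp add: ellK_def zero_ereal_def)
qed

text \<open>Landen's amplitude is \<open>\<theta> = v + \<psi>\<close> with
  \<open>tan \<psi> = (q / p) tan v\<close>; the formulas for sine and cosine are the addition
  theorems for \<open>cos \<psi> = p cos v / D\<close> and \<open>sin \<psi> = q sin v / D\<close>.
  As \<open>p\<^sup>2 - q\<^sup>2 = m n\<close>, the radical in the coordinate z is
  \<open>D / p\<close>, so \<open>coord_y\<close> has derivative \<open>1 / D\<close>. The integrand
  of modulus \<open>m / n\<close> pulls back to the same expression.\<close>

lemma landen_substitution:
  fixes v :: real
  defines "p \<equiv> (n + m) / 2" and "q \<equiv> (n - m) / 2"
  defines "D \<equiv> \<lambda>v. sqrt (p\<^sup>2 * (cos v)\<^sup>2 + q\<^sup>2 * (sin v)\<^sup>2)"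
  obtains \<theta> where "sin \<theta> = n * (cos v * sin v) / D v"
    "cos \<theta> = (p * (cos v)\<^sup>2 - q * (sin v)\<^sup>2) / D v"
    "sqrt (n\<^sup>2 - m\<^sup>2 * (sin \<theta>)\<^sup>2) = n * (p * (cos v)\<^sup>2 + q * (sin v)\<^sup>2) / D v"
    "coord_y n m v = elliptic_F n m (pi / 2) + elliptic_F n m \<theta>"
proof -
  have pq: "p > 0" "q > 0" "n = p + q" "m = p - q" using nm by (auto simp: p_def q_def field_simps)
  have combo_pos: "a * (cos v)\<^sup>2 + b * (sin v)\<^sup>2 > 0" if "a > 0" "b > 0" for a b v :: real
  proof (cases "cos v = 0")
    case True
    then have "sin v \<noteq> 0" using sin_cos_squared_add[of v] by auto
    then show ?thesis using True that by simp
  qed (use that in \<open>simp add: add_pos_nonneg\<close>)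
  define Q where "Q = (\<lambda>v. p\<^sup>2 * (cos v)\<^sup>2 + q\<^sup>2 * (sin v)\<^sup>2)"
  have Q_pos: "Q v > 0" for v unfolding Q_def by (rule combo_pos) (use pq in auto)
  have Q_ne: "Q v \<noteq> 0" for v using Q_pos[of v] by simp
  have D_pos: "D v > 0" and D2: "(D v)\<^sup>2 = Q v" for v
    using Q_pos[of v] by (auto simp: D_def Q_def)
  define R where "R = (\<lambda>v. p * (cos v)\<^sup>2 + q * (sin v)\<^sup>2)"
  have R_pos: "R v > 0" for v unfolding R_def by (rule combo_pos) (use pq in auto)
  \<comment> \<open>The integrand equals \<open>1 + p q / Q\<close>, the derivative of
    \<open>v + \<psi>\<close>. Integrating it defines the angle for all \<open>v\<close> at
    once.\<close>
  define \<theta> where "\<theta> = (\<lambda>v::real. LBINT t=0..v. n * R t / Q t)"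
  have \<theta>: "(\<theta> has_real_derivative n * R v / Q v) (at v)" for v
    unfolding \<theta>_def
  proof (rule LBINT_has_real_derivative)
    have "continuous_on UNIV Q" "continuous_on UNIV R"
      unfolding Q_def R_def by (intro continuous_intros)+
    then show "continuous_on UNIV (\<lambda>t. n * R t / Q t)"
      by (intro continuous_intros ballI Q_ne)
  qed
  have \<theta>0: "\<theta> 0 = 0" by (simp add: \<theta>_def zero_ereal_def)
  \<comment> \<open>\<open>(a, b)\<close> moves on the unit circle with angular velocity \<open>\<theta>'\<close>, hence equals \<open>(cos \<theta>, sin \<theta>)\<close>;
    this avoids the branches of \<open>\<theta> = v + arctan (q/p tan v)\<close>.\<close>
  define a b where "a = (\<lambda>v. (p * (cos v)\<^sup>2 - q * (sin v)\<^sup>2) / D v)" and "b = (\<lambda>v. n * (cos v * sin v) / D v)"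
  have dD: "(D has_real_derivative - (p\<^sup>2 - q\<^sup>2) * (sin v * cos v) / D v) (at v)" for v
    unfolding D_def using Q_pos[of v, unfolded Q_def]
    by (auto intro!: derivative_eq_intros simp: field_simps)
  have da: "(a has_real_derivative - b v * (n * R v / Q v)) (at v)" for v
  proof -
    have "(a has_real_derivative ((- 2 * (p + q) * (sin v * cos v)) * D v -
        (p * (cos v)\<^sup>2 - q * (sin v)\<^sup>2) * (- (p\<^sup>2 - q\<^sup>2) * (sin v * cos v) / D v)) / (D v * D v)) (at v)"
      unfolding a_def using D_pos[of v]
      by (auto intro!: derivative_eq_intros dD simp: algebra_simps)
    moreover have "((- 2 * (p + q) * (sin v * cos v)) * D v -
        (p * (cos v)\<^sup>2 - q * (sin v)\<^sup>2) * (- (p\<^sup>2 - q\<^sup>2) * (sin v * cos v) / D v)) / (D v * D v)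
        = sin v * cos v * (- 2 * (p + q) * Q v + (p * (cos v)\<^sup>2 - q * (sin v)\<^sup>2) * (p\<^sup>2 - q\<^sup>2)) / (D v * Q v)"
      unfolding D2[symmetric] using D_pos[of v] by (simp add: field_simps power2_eq_square)
    moreover have "- 2 * (p + q) * Q v + (p * (cos v)\<^sup>2 - q * (sin v)\<^sup>2) * (p\<^sup>2 - q\<^sup>2) = - n * (n * R v)"
      unfolding Q_def R_def pq(3) sin_squared_eq by (simp add: algebra_simps power2_eq_square)
    ultimately show ?thesis by (simp add: b_def mult_ac)
  qed
  have db: "(b has_real_derivative a v * (n * R v / Q v)) (at v)" for v
  proof -
    have "(b has_real_derivative (n * ((cos v)\<^sup>2 - (sin v)\<^sup>2) * D v -
        n * (cos v * sin v) * (- (p\<^sup>2 - q\<^sup>2) * (sin v * cos v) / D v)) / (D v * D v)) (at v)"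
      unfolding b_def using D_pos[of v]
      by (auto intro!: derivative_eq_intros dD simp: algebra_simps power2_eq_square)
    moreover have "(n * ((cos v)\<^sup>2 - (sin v)\<^sup>2) * D v -
        n * (cos v * sin v) * (- (p\<^sup>2 - q\<^sup>2) * (sin v * cos v) / D v)) / (D v * D v)
        = n * (((cos v)\<^sup>2 - (sin v)\<^sup>2) * Q v + (cos v)\<^sup>2 * (sin v)\<^sup>2 * (p\<^sup>2 - q\<^sup>2)) / (D v * Q v)"
      unfolding D2[symmetric] using D_pos[of v] by (simp add: field_simps power2_eq_square)
    moreover have "((cos v)\<^sup>2 - (sin v)\<^sup>2) * Q v + (cos v)\<^sup>2 * (sin v)\<^sup>2 * (p\<^sup>2 - q\<^sup>2)
        = (p * (cos v)\<^sup>2 - q * (sin v)\<^sup>2) * R v"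
      unfolding Q_def R_def sin_squared_eq by (simp add: algebra_simps power2_eq_square)
    ultimately show ?thesis by (simp add: a_def mult_ac)
  qed
  have ab0: "a 0 = 1" "b 0 = 0" using pq by (simp_all add: a_def b_def D_def)
  \<comment> \<open>\<open>A\<close> and \<open>B\<close> are the real and imaginary parts of
    \<open>(a + i b) exp (- i \<theta>) = 1\<close>.\<close>
  have A: "a v * cos (\<theta> v) + b v * sin (\<theta> v) = 1" for v
  proof -
    have "((\<lambda>v. a v * cos (\<theta> v) + b v * sin (\<theta> v)) has_real_derivative 0) (at v)" for v
      by (auto intro!: derivative_eq_intros da db \<theta> simp: algebra_simps)
    from DERIV_eq_imp_eq[OF this DERIV_const, of 0 1 v] show ?thesis by (simp add: ab0 \<theta>0)
  qed
  have B: "b v * cos (\<theta> v) - a v * sin (\<theta> v) = 0" for v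
  proof -
    have "((\<lambda>v. b v * cos (\<theta> v) - a v * sin (\<theta> v)) has_real_derivative 0) (at v)" for v
      by (auto intro!: derivative_eq_intros da db \<theta> simp: algebra_simps)
    from DERIV_eq_imp_eq[OF this DERIV_const, of 0 0 v] show ?thesis by (simp add: ab0 \<theta>0)
  qed
  have cos_\<theta>: "cos (\<theta> v) = a v" and sin_\<theta>: "sin (\<theta> v) = b v" for v
  proof -
    have "a v = a v * ((cos (\<theta> v))\<^sup>2 + (sin (\<theta> v))\<^sup>2)" by simp
    also have "\<dots> = cos (\<theta> v) * (a v * cos (\<theta> v) + b v * sin (\<theta> v)) - sin (\<theta> v) * (b v * cos (\<theta> v) - a v * sin (\<theta> v))"
      by algebra
    finally show "cos (\<theta> v) = a v" unfolding A B by simp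
    have "b v = b v * ((cos (\<theta> v))\<^sup>2 + (sin (\<theta> v))\<^sup>2)" by simp
    also have "\<dots> = sin (\<theta> v) * (a v * cos (\<theta> v) + b v * sin (\<theta> v)) + cos (\<theta> v) * (b v * cos (\<theta> v) - a v * sin (\<theta> v))"
      by algebra
    finally show "sin (\<theta> v) = b v" unfolding A B by simp
  qed
  have E: "sqrt (n\<^sup>2 - m\<^sup>2 * (sin (\<theta> v))\<^sup>2) = n * R v / D v" for v
  proof (rule real_sqrt_unique)
    \<comment> \<open>Multiplying \<open>Q\<close> by \<open>cos\<^sup>2 + sin\<^sup>2\<close> and
      subtracting \<open>(p - q)\<^sup>2 cos\<^sup>2 sin\<^sup>2\<close> leaves a perfect square, so
      the elliptic radical is rational in \<open>cos v\<close>, \<open>sin v\<close> and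
      \<open>D\<close>.\<close>
    have "Q v - m\<^sup>2 * ((cos v)\<^sup>2 * (sin v)\<^sup>2) = (R v)\<^sup>2"
      unfolding Q_def R_def pq(4) sin_squared_eq by (simp add: algebra_simps power2_eq_square)
    then have "n\<^sup>2 * (R v)\<^sup>2 / Q v = n\<^sup>2 * (Q v - m\<^sup>2 * ((cos v)\<^sup>2 * (sin v)\<^sup>2)) / Q v" by simp
    also have "\<dots> = n\<^sup>2 - m\<^sup>2 * (n\<^sup>2 * ((cos v)\<^sup>2 * (sin v)\<^sup>2) / Q v)"
      using Q_pos[of v] by (simp add: field_simps)
    finally show "(n * R v / D v)\<^sup>2 = n\<^sup>2 - m\<^sup>2 * (sin (\<theta> v))\<^sup>2"
      by (simp add: sin_\<theta> b_def power_divide power_mult_distrib D2)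
    show "0 \<le> n * R v / D v" using R_pos[of v] D_pos[of v] nm by simp
  qed
  have dF: "((\<lambda>v. elliptic_F n m (pi / 2) + elliptic_F n m (\<theta> v)) has_real_derivative 1 / D v) (at v)" for v
  proof -
    have "((\<lambda>v. elliptic_F n m (\<theta> v)) has_real_derivative 1 / (n * R v / D v) * (n * R v / Q v)) (at v)"
      using DERIV_chain2[OF elliptic_F_deriv \<theta>[of v]] unfolding E .
    moreover have "1 / (n * R v / D v) * (n * R v / Q v) = 1 / D v"
      unfolding D2[symmetric] using nm R_pos[of v] D_pos[of v] by (simp add: field_simps power2_eq_square)
    ultimately show ?thesis by (auto intro!: derivative_eq_intros)
  qed
  have dy: "(coord_y n m has_real_derivative 1 / D v) (at v)" for v
  proof -
    define \<kappa> where "\<kappa> = (2 * sqrt (m * n) / (n + m))\<^sup>2"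
    have \<kappa>: "1 - \<kappa> * (sin t)\<^sup>2 = Q t / p\<^sup>2" for t
    proof -
      have "\<kappa> = (p\<^sup>2 - q\<^sup>2) / p\<^sup>2"
        using nm unfolding \<kappa>_def p_def q_def
        by (simp add: power_divide power_mult_distrib field_simps power2_eq_square)
      then have "\<kappa> * p\<^sup>2 = p\<^sup>2 - q\<^sup>2" using pq by simp
      then have "Q t = (1 - \<kappa> * (sin t)\<^sup>2) * p\<^sup>2"
        unfolding Q_def cos_squared_eq by algebra
      then show ?thesis using pq by simp
    qed
    have dL: "((\<lambda>u. LBINT t=0..u. 1 / sqrt (1 - \<kappa> * (sin t)\<^sup>2)) has_real_derivative
        1 / sqrt (1 - \<kappa> * (sin v)\<^sup>2)) (at v)"
    proof (rule LBINT_has_real_derivative, intro continuous_intros)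
      show "\<forall>x\<in>UNIV. sqrt (1 - \<kappa> * (sin x)\<^sup>2) \<noteq> 0"
        unfolding \<kappa> using Q_ne pq by simp
    qed
    have E1: "2 * (1 / (n + m)) * (1 / sqrt (1 - \<kappa> * (sin v)\<^sup>2)) = 1 / D v"
    proof -
      have "n + m = 2 * p" by (simp add: p_def)
      then show ?thesis
        unfolding \<kappa> using pq(1) by (simp add: real_sqrt_divide D_def Q_def)
    qed
    have "((\<lambda>u. 2 * (1 / (n + m)) * (LBINT t=0..u. 1 / sqrt (1 - \<kappa> * (sin t)\<^sup>2)) + 1 / n * ellK (m / n))
        has_real_derivative 1 / D v + 0) (at v)"
      by (rule DERIV_add[OF DERIV_cmult[OF dL, of "2 * (1 / (n + m))", unfolded E1] DERIV_const])
    moreover have "coord_y n m = (\<lambda>u. 2 * (1 / (n + m)) * (LBINT t=0..u. 1 / sqrt (1 - \<kappa> * (sin t)\<^sup>2)) + 1 / n * ellK (m / n))"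
      by (simp add: fun_eq_iff coord_y_def coord_z_def \<kappa>_def)
    ultimately show ?thesis by simp
  qed
  have y0: "coord_y n m 0 = elliptic_F n m (pi / 2) + elliptic_F n m (\<theta> 0)"
    unfolding coord_y_def ellK_eq_elliptic_F by (simp add: coord_z_def \<theta>0 zero_ereal_def)
  have "coord_y n m v = elliptic_F n m (pi / 2) + elliptic_F n m (\<theta> v)"
    using DERIV_eq_imp_eq[OF dy dF y0] .
  from that[OF sin_\<theta>[of v, unfolded b_def] cos_\<theta>[of v, unfolded a_def] E[of v, unfolded R_def] this]
  show ?thesis .
qed

end

text \<open>In \<open>phi0\<close> and \<open>phi2\<close> the parameter counts from the pole at
  \<open>y = 0\<close>, whereas \<open>\<theta> = 0\<close> belongs to y equal to a quarter period,
  \<open>elliptic_F n m (pi / 2)\<close>; hence they are evaluated at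
  \<open>\<theta> + pi / 2\<close>. The further quarter period inside \<open>phi1\<close> moves its
  argument to \<open>elliptic_F n m (\<theta> + pi)\<close>.\<close>

lemma phi_values:
  fixes n m v :: real
  assumes nm: "0 < m" "m < n"
  defines "p \<equiv> (n + m) / 2" and "q \<equiv> (n - m) / 2"
  defines "D \<equiv> sqrt (p\<^sup>2 * (cos v)\<^sup>2 + q\<^sup>2 * (sin v)\<^sup>2)"
  shows "phi0 n m (coord_y n m v) = - (sqrt (p\<^sup>2 + q\<^sup>2) * (cos v * sin v) / D)"
    and "phi1 n m (coord_y n m v) = (p * (cos v)\<^sup>2 - q * (sin v)\<^sup>2) / (sqrt 2 * D)"
    and "phi2 n m (coord_y n m v) = (p * (cos v)\<^sup>2 + q * (sin v)\<^sup>2) / (sqrt 2 * D)"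
    and "(phi0 n m (coord_y n m v))\<^sup>2 + (phi1 n m (coord_y n m v))\<^sup>2 + (phi2 n m (coord_y n m v))\<^sup>2 = 1"
proof -
  obtain \<theta> where \<theta>: "sin \<theta> = n * (cos v * sin v) / D"
    "cos \<theta> = (p * (cos v)\<^sup>2 - q * (sin v)\<^sup>2) / D"
    "sqrt (n\<^sup>2 - m\<^sup>2 * (sin \<theta>)\<^sup>2) = n * (p * (cos v)\<^sup>2 + q * (sin v)\<^sup>2) / D"
    "coord_y n m v = elliptic_F n m (pi / 2) + elliptic_F n m \<theta>"
    by (rule landen_substitution[OF nm, of v, folded p_def q_def, folded D_def]) (rule that)
  have n: "n > 0" using nm by simp
  have shift: "sin (u + - (pi / 2)) = - cos u" "cos (u + pi / 2) = - sin u" for u :: real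
    by (simp_all add: sin_diff cos_add)
  define y where "y = (\<lambda>u. elliptic_F n m (u + - (pi / 2)) + elliptic_F n m (pi / 2))"
  have y: "(y has_real_derivative 1 / sqrt (n\<^sup>2 - m\<^sup>2 * (cos u)\<^sup>2)) (at u)" for u
    unfolding y_def using elliptic_F_shift_deriv[OF nm, of "- (pi / 2)" u] unfolding shift
    by (auto intro!: derivative_eq_intros)
  have y0: "y 0 = 0" by (simp add: y_def elliptic_F_minus[OF nm])
  have y\<theta>: "coord_y n m v = y (\<theta> + pi / 2)" by (simp add: y_def \<theta>(4))
  have 0: "phi0 n m (coord_y n m v) = sqrt ((n\<^sup>2 + m\<^sup>2) / (2 * n\<^sup>2)) * - sin \<theta>"
    unfolding y\<theta> phi0_eq[OF nm y y0] shift ..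
  have 2: "phi2 n m (coord_y n m v) = sqrt (n\<^sup>2 - m\<^sup>2 * (sin \<theta>)\<^sup>2) / (sqrt 2 * n)"
    unfolding y\<theta> phi2_eq[OF nm y y0] shift by simp
  have "coord_y n m v + 1 / n * ellK (m / n) = elliptic_F n m (\<theta> + pi)"
    using ellK_eq_elliptic_F[OF nm] unfolding \<theta>(4) elliptic_F_plus_pi[OF nm] by simp
  then have 1: "phi1 n m (coord_y n m v) = cos \<theta> / sqrt 2"
    using phi1_eq[OF nm elliptic_F_deriv[OF nm] elliptic_F_0[OF nm]] by simp
  have "(n\<^sup>2 + m\<^sup>2) / 2 = p\<^sup>2 + q\<^sup>2"
    by (simp add: p_def q_def power2_eq_square field_simps)
  then have pq: "(n\<^sup>2 + m\<^sup>2) / (2 * n\<^sup>2) = (p\<^sup>2 + q\<^sup>2) / n\<^sup>2"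
    by (metis divide_divide_eq_left)
  show "phi0 n m (coord_y n m v) = - (sqrt (p\<^sup>2 + q\<^sup>2) * (cos v * sin v) / D)"
    using n unfolding 0 pq \<theta>(1) by (simp add: real_sqrt_divide)
  show "phi1 n m (coord_y n m v) = (p * (cos v)\<^sup>2 - q * (sin v)\<^sup>2) / (sqrt 2 * D)"
    unfolding 1 \<theta>(2) by simp
  show "phi2 n m (coord_y n m v) = (p * (cos v)\<^sup>2 + q * (sin v)\<^sup>2) / (sqrt 2 * D)"
    using n unfolding 2 \<theta>(3) by simp
  have s0: "(phi0 n m (coord_y n m v))\<^sup>2 = (n\<^sup>2 + m\<^sup>2) / (2 * n\<^sup>2) * (sin \<theta>)\<^sup>2"
    unfolding 0 by (simp add: power_mult_distrib)
  have s1: "(phi1 n m (coord_y n m v))\<^sup>2 = (1 - (sin \<theta>)\<^sup>2) / 2"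
    unfolding 1 by (simp add: power_divide cos_squared_eq)
  have s2: "(phi2 n m (coord_y n m v))\<^sup>2 = (n\<^sup>2 - m\<^sup>2 * (sin \<theta>)\<^sup>2) / (2 * n\<^sup>2)"
    unfolding 2 using elliptic_radicand_pos[OF nm, of \<theta>] by (simp add: power_divide power_mult_distrib)
  show "(phi0 n m (coord_y n m v))\<^sup>2 + (phi1 n m (coord_y n m v))\<^sup>2 + (phi2 n m (coord_y n m v))\<^sup>2 = 1"
    unfolding s0 s1 s2 using n by (simp add: field_simps)
qed

section \<open>The bipolar surface\<close>

lemma C_diff_const: "C_diff j (\<lambda>_. c)"
  by (induction j arbitrary: c) simp_all

lemma smooth_map_ident: "smooth_map (\<lambda>x. x)"
proof -
  have "C_diff j (\<lambda>x :: 'a. x)" for j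
    by (cases j) (simp_all add: C_diff_const)
  then show ?thesis by (simp add: smooth_map_def)
qed

lemma id_in_bipolar_group: "id \<in> bipolar_group r k"
  using smooth_map_ident unfolding bipolar_group_def diffeo_def by (simp add: id_def[symmetric])

text \<open>Members of the group preserve the lift, and the identity puts \<open>p\<close> into its
  own orbit, so the image of the orbit is a singleton. Claims about the quotient thereby reduce to
  the lift.\<close>

lemma bipolar_immersion_proj: "bipolar_immersion r k (bipolar_proj r k p) = bipolar_lift r k p"
proof -
  have "bipolar_lift r k ` bipolar_proj r k p = {bipolar_lift r k p}"
  proof (rule equalityI)
    show "bipolar_lift r k ` bipolar_proj r k p \<subseteq> {bipolar_lift r k p}"
      unfolding bipolar_proj_def bipolar_group_def by (auto simp del: split_paired_All dest: fun_cong[of _ _ p])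
    show "{bipolar_lift r k p} \<subseteq> bipolar_lift r k ` bipolar_proj r k p"
    proof -
      have "p \<in> bipolar_proj r k p"
        unfolding bipolar_proj_def by (rule image_eqI[OF _ id_in_bipolar_group]) simp
      then show ?thesis by blast
    qed
  qed
  then show ?thesis by (simp add: bipolar_immersion_def)
qed

section \<open>Coordinates on the second exterior power\<close>

lemma exhaust_5:
  fixes x :: 5
  shows "x = 1 \<or> x = 2 \<or> x = 3 \<or> x = 4 \<or> x = 5"
proof (induct x)
  case (of_int z)
  then have "z = 0 \<or> z = 1 \<or> z = 2 \<or> z = 3 \<or> z = 4" by fastforce
  then show ?case by auto
qed

lemma exhaust_6:
  fixes x :: 6
  shows "x = 1 \<or> x = 2 \<or> x = 3 \<or> x = 4 \<or> x = 5 \<or> x = 6"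
proof (induct x)
  case (of_int z)
  then have "z = 0 \<or> z = 1 \<or> z = 2 \<or> z = 3 \<or> z = 4 \<or> z = 5" by fastforce
  then show ?case by auto
qed

lemma forall_5: "(\<forall>i::5. P i) \<longleftrightarrow> P 1 \<and> P 2 \<and> P 3 \<and> P 4 \<and> P 5"
  by (metis exhaust_5)

lemma UNIV_5: "UNIV = {1, 2, 3, 4, 5::5}"
  using exhaust_5 by auto

lemma UNIV_6: "UNIV = {1, 2, 3, 4, 5, 6::6}"
  using exhaust_6 by auto

lemma sum_5: "sum f (UNIV::5 set) = f 1 + f 2 + f 3 + f 4 + f 5"
  unfolding UNIV_5 by (simp add: ac_simps)

lemma sum_6: "sum f (UNIV::6 set) = f 1 + f 2 + f 3 + f 4 + f 5 + f 6"
  unfolding UNIV_6 by (simp add: ac_simps)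

lemma vector_5:
  "(vector [a, b, c, d, e] :: 'a::zero ^ 5) $ 1 = a"
  "(vector [a, b, c, d, e] :: 'a ^ 5) $ 2 = b"
  "(vector [a, b, c, d, e] :: 'a ^ 5) $ 3 = c"
  "(vector [a, b, c, d, e] :: 'a ^ 5) $ 4 = d"
  "(vector [a, b, c, d, e] :: 'a ^ 5) $ 5 = e"
  unfolding vector_def by simp_all

lemma vector_6:
  "(vector [a, b, c, d, e, f] :: 'a::zero ^ 6) $ 1 = a"
  "(vector [a, b, c, d, e, f] :: 'a ^ 6) $ 2 = b"
  "(vector [a, b, c, d, e, f] :: 'a ^ 6) $ 3 = c"
  "(vector [a, b, c, d, e, f] :: 'a ^ 6) $ 4 = d"
  "(vector [a, b, c, d, e, f] :: 'a ^ 6) $ 5 = e"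
  "(vector [a, b, c, d, e, f] :: 'a ^ 6) $ 6 = f"
  unfolding vector_def by simp_all

lemma vector_4:
  "(vector [a, b, c, d] :: 'a::zero ^ 4) $ 1 = a"
  "(vector [a, b, c, d] :: 'a ^ 4) $ 2 = b"
  "(vector [a, b, c, d] :: 'a ^ 4) $ 3 = c"
  "(vector [a, b, c, d] :: 'a ^ 4) $ 4 = d"
  unfolding vector_def by simp_all

text \<open>The components along \<open>e1 \<and> e2\<close> and \<open>e3 \<and> e4\<close> lose
  the angles \<open>r u\<close> and \<open>k u\<close> by the Pythagorean relations and become
  \<open>- k\<close> and \<open>r\<close> times a common factor. This proportionality puts the image
  into a hyperplane.\<close>

lemma wedge_lawson:
  fixes ca sa cb sb c s r k J :: real
  assumes "ca\<^sup>2 + sa\<^sup>2 = 1" "cb\<^sup>2 + sb\<^sup>2 = 1"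
  shows "wedge (vector [ca * c, sa * c, cb * s, sb * s])
      (J *\<^sub>R vector [k * sa * s, - k * ca * s, - r * sb * c, r * cb * c])
    = vector [- (k * (c * s) * J),
     - ((r * c\<^sup>2 * (ca * sb) + k * s\<^sup>2 * (sa * cb)) * J),
     (r * c\<^sup>2 * (ca * cb) - k * s\<^sup>2 * (sa * sb)) * J,
     (k * s\<^sup>2 * (ca * cb) - r * c\<^sup>2 * (sa * sb)) * J,
     (r * c\<^sup>2 * (sa * cb) + k * s\<^sup>2 * (ca * sb)) * J,
     r * (c * s) * J]"
proof -
  have 1: "ca * c * (J * (- k * ca * s)) - sa * c * (J * (k * sa * s)) = - (k * (c * s) * J)"
    using assms(1) by algebra
  have 6: "cb * s * (J * (r * cb * c)) - sb * s * (J * (- r * sb * c)) = r * (c * s) * J"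
    using assms(2) by algebra
  show ?thesis
    unfolding wedge_def vector_scaleR_component real_scaleR_def vector_4 1 6
    by (intro arg_cong[where f = vector]) (simp add: power2_eq_square algebra_simps)
qed

lemma bipolar_lift_eq:
  fixes r k :: int and u v :: real
  defines "A \<equiv> r * (cos v)\<^sup>2" and "B \<equiv> k * (sin v)\<^sup>2"
    and "D \<equiv> sqrt (r\<^sup>2 * (cos v)\<^sup>2 + k\<^sup>2 * (sin v)\<^sup>2)"
  shows "bipolar_lift r k (u, v) = vector
    [- (k * (cos v * sin v) * (1 / D)),
     - ((A * (cos (r * u) * sin (k * u)) + B * (sin (r * u) * cos (k * u))) * (1 / D)),
     (A * (cos (r * u) * cos (k * u)) - B * (sin (r * u) * sin (k * u))) * (1 / D),
     (B * (cos (r * u) * cos (k * u)) - A * (sin (r * u) * sin (k * u))) * (1 / D),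
     (A * (sin (r * u) * cos (k * u)) + B * (cos (r * u) * sin (k * u))) * (1 / D),
     r * (cos v * sin v) * (1 / D)]"
  using wedge_lawson[of "cos (r * u)" "sin (r * u)" "cos (k * u)" "sin (k * u)" "cos v" "sin v" "1 / D" "real_of_int k" "real_of_int r"]
  by (simp add: bipolar_lift_def lawson_def lawson_normal_def A_def B_def D_def)

text \<open>The normal \<open>a\<close> annihilates \<open>(- k, r)\<close> in components 1 and 6,
  and the first row of \<open>L\<close> is the unit vector orthogonal to \<open>a\<close> in that
  plane. The other rows are normalised anti-self-dual (rows 2, 3) and self-dual (rows 4, 5)
  combinations of the basis bivectors; on the lift they separate the angles \<open>(r - k) u\<close>
  and \<open>(r + k) u\<close>.\<close>

lemma bipolar_hyperplane_isometry:
  fixes r k :: real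
  assumes "r \<noteq> 0"
  defines "a \<equiv> vector [r, 0, 0, 0, 0, k] :: real^6"
  defines "L \<equiv> \<lambda>w :: real^6. vector
    [(k * w $ 1 - r * w $ 6) / sqrt (r\<^sup>2 + k\<^sup>2), (w $ 3 - w $ 4) / sqrt 2, (w $ 5 + w $ 2) / sqrt 2,
     (w $ 3 + w $ 4) / sqrt 2, (w $ 5 - w $ 2) / sqrt 2] :: real^5"
  shows "a \<noteq> 0" "linear L" "\<And>w. a \<bullet> w = 0 \<Longrightarrow> norm (L w) = norm w" "L ` {w. a \<bullet> w = 0} = UNIV"
proof -
  have inner_a: "a \<bullet> w = r * w $ 1 + k * w $ 6" for w
    by (simp add: inner_vec_def sum_6 a_def vector_6)
  have pos: "r\<^sup>2 + k\<^sup>2 > 0" using assms(1) by (simp add: add_pos_nonneg)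
  show "a \<noteq> 0"
    using assms(1) vector_6(1)[of r 0 0 0 0 k] by (auto simp: a_def)
  show "linear L"
    by (rule linearI) (simp_all add: L_def vec_eq_iff forall_5 vector_5 add_divide_distrib diff_divide_distrib algebra_simps)
  show "norm (L w) = norm w" if "a \<bullet> w = 0" for w
  proof -
    \<comment> \<open>Lagrange's identity in the plane of components 1 and 6: once the part along
      \<open>(r, k)\<close> vanishes, the part along \<open>(k, - r)\<close> has full
      length.\<close>
    have "(k * w $ 1 - r * w $ 6)\<^sup>2 = (r\<^sup>2 + k\<^sup>2) * ((w $ 1)\<^sup>2 + (w $ 6)\<^sup>2) - (r * w $ 1 + k * w $ 6)\<^sup>2"
      by (simp add: power2_eq_square algebra_simps)
    also have "r * w $ 1 + k * w $ 6 = 0" using that by (simp add: inner_a)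
    finally have "(k * w $ 1 - r * w $ 6)\<^sup>2 / (r\<^sup>2 + k\<^sup>2) = (w $ 1)\<^sup>2 + (w $ 6)\<^sup>2"
      using pos assms(1) by simp
    moreover have "L w \<bullet> L w = (k * w $ 1 - r * w $ 6)\<^sup>2 / (r\<^sup>2 + k\<^sup>2)
        + (w $ 3 - w $ 4)\<^sup>2 / 2 + (w $ 5 + w $ 2)\<^sup>2 / 2 + (w $ 3 + w $ 4)\<^sup>2 / 2 + (w $ 5 - w $ 2)\<^sup>2 / 2"
      using pos by (simp add: inner_vec_def sum_5 L_def vector_5 power_divide flip: power2_eq_square)
    moreover have "(w $ 3 - w $ 4)\<^sup>2 / 2 + (w $ 5 + w $ 2)\<^sup>2 / 2 + (w $ 3 + w $ 4)\<^sup>2 / 2 + (w $ 5 - w $ 2)\<^sup>2 / 2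
        = (w $ 2)\<^sup>2 + (w $ 3)\<^sup>2 + (w $ 4)\<^sup>2 + (w $ 5)\<^sup>2"
      by (simp add: power2_eq_square field_simps)
    ultimately have "L w \<bullet> L w = w \<bullet> w"
      by (simp add: inner_vec_def sum_6 flip: power2_eq_square)
    then show ?thesis by (simp add: norm_eq_sqrt_inner)
  qed
  show "L ` {w. a \<bullet> w = 0} = UNIV"
  proof (intro equalityI subsetI UNIV_I)
    fix e :: "real^5"
    define N where "N = sqrt (r\<^sup>2 + k\<^sup>2)"
    \<comment> \<open>The preimage is the transpose of \<open>L\<close> applied to
      \<open>e\<close>.\<close>
    define w :: "real^6" where "w = vector [k * e $ 1 / N, (e $ 3 - e $ 5) / sqrt 2, (e $ 2 + e $ 4) / sqrt 2,
      (e $ 4 - e $ 2) / sqrt 2, (e $ 3 + e $ 5) / sqrt 2, - (r * e $ 1 / N)]"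
    have N: "N > 0" "N * N = r * r + k * k" using pos by (simp_all add: N_def flip: power2_eq_square)
    have "(k * (k * e $ 1 / N) - r * (- (r * e $ 1 / N))) / N = e $ 1"
    proof -
      have "(k * (k * e $ 1 / N) - r * (- (r * e $ 1 / N))) / N = (r * r + k * k) * e $ 1 / (N * N)"
        using N(1) by (simp add: field_simps)
      then show ?thesis unfolding N(2)[symmetric] using N(1) by simp
    qed
    then have "L w = e"
      unfolding L_def N_def[symmetric] vec_eq_iff forall_5 vector_5
      by (simp add: w_def vector_6 add_divide_distrib diff_divide_distrib)
    moreover have "a \<bullet> w = 0" by (simp add: inner_a w_def vector_6)
    ultimately show "e \<in> L ` {w. a \<bullet> w = 0}" by force
  qed
qed


text \<open>The values in terms of \<open>p\<close> and \<open>q\<close> are homogeneous of degree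
  0, and \<open>r = l p\<close>, \<open>k = l q\<close>, so the factor \<open>l\<close> cancels. In
  the application \<open>l\<close> is 1 or 2 according to the parity of \<open>r k\<close>.\<close>

lemma phi_values_scaled:
  fixes r k n m l v :: real
  assumes "0 < k" "k < r" "0 < l" "l * n = r + k" "l * m = r - k"
  defines "D \<equiv> sqrt (r\<^sup>2 * (cos v)\<^sup>2 + k\<^sup>2 * (sin v)\<^sup>2)"
  shows "phi0 n m (coord_y n m v) = - (sqrt (r\<^sup>2 + k\<^sup>2) * (cos v * sin v) / D)"
    and "phi1 n m (coord_y n m v) = (r * (cos v)\<^sup>2 - k * (sin v)\<^sup>2) / (sqrt 2 * D)"
    and "phi2 n m (coord_y n m v) = (r * (cos v)\<^sup>2 + k * (sin v)\<^sup>2) / (sqrt 2 * D)"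
    and "(phi0 n m (coord_y n m v))\<^sup>2 + (phi1 n m (coord_y n m v))\<^sup>2 + (phi2 n m (coord_y n m v))\<^sup>2 = 1"
proof -
  define p q where "p = (n + m) / 2" and "q = (n - m) / 2"
  have "0 < l * m" "l * m < l * n" using assms(1-5) by simp_all
  then have nm: "0 < m" "m < n" using assms(3) by (simp_all add: zero_less_mult_iff)
  have "l * (n + m) = 2 * r" "l * (n - m) = 2 * k"
    using assms(4,5) by (simp_all add: distrib_left right_diff_distrib)
  then have rk: "r = l * p" "k = l * q" by (simp_all add: p_def q_def)
  have D: "D = l * sqrt (p\<^sup>2 * (cos v)\<^sup>2 + q\<^sup>2 * (sin v)\<^sup>2)"
  proof -
    have "r\<^sup>2 * (cos v)\<^sup>2 + k\<^sup>2 * (sin v)\<^sup>2 = l\<^sup>2 * (p\<^sup>2 * (cos v)\<^sup>2 + q\<^sup>2 * (sin v)\<^sup>2)"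
      by (simp add: rk power_mult_distrib algebra_simps)
    then show ?thesis using assms(3) by (simp add: D_def real_sqrt_mult)
  qed
  have "r\<^sup>2 + k\<^sup>2 = l\<^sup>2 * (p\<^sup>2 + q\<^sup>2)" by (simp add: rk power_mult_distrib algebra_simps)
  then have S: "sqrt (r\<^sup>2 + k\<^sup>2) = l * sqrt (p\<^sup>2 + q\<^sup>2)" using assms(3) by (simp add: real_sqrt_mult)
  note vals = phi_values[OF nm, of v, folded p_def q_def]
  show "phi0 n m (coord_y n m v) = - (sqrt (r\<^sup>2 + k\<^sup>2) * (cos v * sin v) / D)"
    unfolding vals(1) S D using assms(3) by simp
  have "r * (cos v)\<^sup>2 - k * (sin v)\<^sup>2 = l * (p * (cos v)\<^sup>2 - q * (sin v)\<^sup>2)"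
    by (simp add: rk algebra_simps)
  then show "phi1 n m (coord_y n m v) = (r * (cos v)\<^sup>2 - k * (sin v)\<^sup>2) / (sqrt 2 * D)"
    unfolding vals(2) D using assms(3) by simp
  have "r * (cos v)\<^sup>2 + k * (sin v)\<^sup>2 = l * (p * (cos v)\<^sup>2 + q * (sin v)\<^sup>2)"
    by (simp add: rk algebra_simps)
  then show "phi2 n m (coord_y n m v) = (r * (cos v)\<^sup>2 + k * (sin v)\<^sup>2) / (sqrt 2 * D)"
    unfolding vals(3) D using assms(3) by simp
  show "(phi0 n m (coord_y n m v))\<^sup>2 + (phi1 n m (coord_y n m v))\<^sup>2 + (phi2 n m (coord_y n m v))\<^sup>2 = 1"
    by (rule vals(4))
qed

lemma bipolar_map_norm:
  assumes "(phi0 n m y)\<^sup>2 + (phi1 n m y)\<^sup>2 + (phi2 n m y)\<^sup>2 = 1"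
  shows "bipolar_map n m x y \<in> sphere 0 1"
proof -
  have "bipolar_map n m x y \<bullet> bipolar_map n m x y = (phi0 n m y)\<^sup>2
      + ((cos (m * x))\<^sup>2 + (sin (m * x))\<^sup>2) * (phi1 n m y)\<^sup>2 + ((cos (n * x))\<^sup>2 + (sin (n * x))\<^sup>2) * (phi2 n m y)\<^sup>2"
    by (simp only: bipolar_map_def inner_vec_def sum_5 vector_5 inner_real_def) algebra
  also have "\<dots> = 1" using assms by simp
  finally show ?thesis by (simp add: norm_eq_sqrt_inner)
qed

theorem theorem1p3p2:
  fixes r k n m :: int
  assumes "0 < k" and "k < r" and "gcd r k = 1"
    and "n = (if even (r * k) then r + k else (r + k) div 2)"
    and "m = (if even (r * k) then r - k else (r - k) div 2)"
  shows "\<exists>(a :: real^6) (L :: real^6 \<Rightarrow> real^5).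
    a \<noteq> 0 \<and> bipolar_immersion r k ` bipolar_surface r k \<subseteq> {w. a \<bullet> w = 0} \<and>
    linear L \<and> (\<forall>w. a \<bullet> w = 0 \<longrightarrow> norm (L w) = norm w) \<and> L ` {w. a \<bullet> w = 0} = UNIV \<and>
    (\<forall>u v. bipolar_map n m (coord_x r k u) (coord_y n m v) \<in> sphere 0 1 \<and>
       L (bipolar_immersion r k (bipolar_proj r k (u, v))) =
       bipolar_map n m (coord_x r k u) (coord_y n m v))"
proof -
  \<comment> \<open>\<open>l\<close> unifies the parities: \<open>x = l u\<close>,
    \<open>l n = r + k\<close> and \<open>l m = r - k\<close>, so \<open>m x\<close> and
    \<open>n x\<close> are \<open>(r - k) u\<close> and \<open>(r + k) u\<close> in both
    cases.\<close>
  define l :: real where "l = (if even (r * k) then 1 else 2)"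
  have l: "l > 0" "l * n = real_of_int r + k" "l * m = real_of_int r - k" "coord_x r k u = l * u" for u
  proof -
    \<comment> \<open>An odd product means that \<open>r\<close> and \<open>k\<close> are both odd,
      so the halves are exact.\<close>
    have "2 * ((r + k) div 2) = r + k" "2 * ((r - k) div 2) = r - k" if "odd (r * k)"
      using that by auto
    then have "real_of_int 2 * real_of_int ((r + k) div 2) = real_of_int r + k"
      "real_of_int 2 * real_of_int ((r - k) div 2) = real_of_int r - k" if "odd (r * k)"
      using that by (metis of_int_mult of_int_add, metis of_int_mult of_int_diff)
    then show "l > 0" "l * n = real_of_int r + k" "l * m = real_of_int r - k" "coord_x r k u = l * u"
      by (auto simp: l_def assms(4,5) coord_x_def)
  qed
  have rk: "real_of_int k > 0" "real_of_int k < real_of_int r" using assms(1,2) by simp_all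
  define a where "a = (vector [real_of_int r, 0, 0, 0, 0, real_of_int k] :: real^6)"
  define L where "L = (\<lambda>w :: real^6. vector
    [(real_of_int k * w $ 1 - real_of_int r * w $ 6) / sqrt ((real_of_int r)\<^sup>2 + (real_of_int k)\<^sup>2),
     (w $ 3 - w $ 4) / sqrt 2, (w $ 5 + w $ 2) / sqrt 2,
     (w $ 3 + w $ 4) / sqrt 2, (w $ 5 - w $ 2) / sqrt 2] :: real^5)"
  have "real_of_int r \<noteq> 0" using rk by simp
  note iso = bipolar_hyperplane_isometry[OF this, of "real_of_int k", folded a_def L_def]
  have norm_L: "norm (L w) = norm w" if "a \<bullet> w = 0" for w
    using iso(3)[OF that] by (simp add: L_def)
  have "a \<bullet> bipolar_lift r k p = 0" for p
    by (cases p) (simp add: a_def inner_vec_def sum_6 vector_6 bipolar_lift_eq)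
  then have sub: "bipolar_immersion r k ` bipolar_surface r k \<subseteq> {w. a \<bullet> w = 0}"
    by (auto simp: bipolar_surface_def bipolar_immersion_proj)
  have map: "L (bipolar_lift r k (u, v)) = bipolar_map n m (coord_x r k u) (coord_y n m v)" for u v
  proof -
    define D where "D = sqrt ((real_of_int r)\<^sup>2 * (cos v)\<^sup>2 + (real_of_int k)\<^sup>2 * (sin v)\<^sup>2)"
    define N where "N = sqrt ((real_of_int r)\<^sup>2 + (real_of_int k)\<^sup>2)"
    have N: "N > 0" "N * N = (real_of_int r)\<^sup>2 + (real_of_int k)\<^sup>2"
      using rk by (simp_all add: N_def add_pos_nonneg)
    note vals = phi_values_scaled(1-3)[OF rk l(1-3), of v, folded D_def N_def]
    have arg: "m * coord_x r k u = r * u - k * u" "n * coord_x r k u = r * u + k * u"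
    proof -
      have "m * (l * u) = (l * m) * u" "n * (l * u) = (l * n) * u" by (simp_all only: mult_ac)
      then show "m * coord_x r k u = r * u - k * u" "n * coord_x r k u = r * u + k * u"
        unfolding l by (simp_all add: algebra_simps)
    qed
    \<comment> \<open>The first coordinate collects
      \<open>- k\<^sup>2 - r\<^sup>2 = - N\<^sup>2\<close>; dividing by \<open>N\<close> leaves the
      coefficient found for \<open>phi0\<close>.\<close>
    have "(- (N * N) * (cos v * sin v) * (1 / D)) / N = - (N * (cos v * sin v) / D)"
      using N(1) by simp
    then have c1: "(real_of_int k * (- (real_of_int k * (cos v * sin v) * (1 / D)))
        - real_of_int r * (real_of_int r * (cos v * sin v) * (1 / D))) / N = - (N * (cos v * sin v) / D)"
      unfolding N(2) by (simp add: power2_eq_square algebra_simps)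
    \<comment> \<open>With \<open>A = r cos\<^sup>2 v\<close> and
      \<open>B = k sin\<^sup>2 v\<close>, the addition formulas give coordinates 2 and 3 the factor
      \<open>A - B\<close> and the angle \<open>(r - k) u\<close>, and coordinates 4 and 5 the
      factor \<open>A + B\<close> and the angle \<open>(r + k) u\<close>.\<close>
    show ?thesis
      unfolding L_def bipolar_map_def vec_eq_iff forall_5 vector_5 vals arg N_def[symmetric]
        bipolar_lift_eq vector_6 of_int_power D_def[symmetric] c1 cos_add cos_diff sin_add sin_diff
      by (simp add: algebra_simps add_divide_distrib diff_divide_distrib)
  qed
  have "bipolar_map n m (coord_x r k u) (coord_y n m v) \<in> sphere 0 1" for u v
    by (rule bipolar_map_norm[OF phi_values_scaled(4)[OF rk l(1-3)]])
  with iso(1,2,4) norm_L sub map show ?thesis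
    by (intro exI[of _ a] exI[of _ L]) (simp add: bipolar_immersion_proj)
qed

end
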